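(* Let $B\in\mathcal{B}$ (with associated positive integer $D_B$ as in the context) and let $a$ be a fixed non-zero integer. There exists a number $x_3=x_3(B)$ such that the following holds. If $x\geq x_3$ and $L$ is a squarefree positive integer not divisible by any prime exceeding $x^{(1-B)/2}$ and satisfying $\sum_{\text{prime } q\mid L}1/q\leq (1-B)/32$, then there is a positive integer $k\leq x^{1-B}+|a|$ with $\gcd(k,aL)=1$ such that $$\#\{ d\mid L:\ dk+a\leq x,\ dk+a\text{ is prime} \}\geq\frac{2^{-D_B-\omega(a)-3}}{\log x}\,\#\{ d\mid L:\ 1\leq d\leq x^B \},$$ where $d$ ranges over positive divisors of $L$ and $\omega(n)$ is the number of distinct prime factors of $|n|$.
   Context: For integers $d\ge1$ and $a$ and real $y$, $\pi(y;d,a)$ denotes the number of primes $p\le y$ with $p\equiv a \pmod d$, $\pi(y)$ the number of primes $p\le y$, and $\varphi$ is Euler's totient function. The set $\mathcal{B}$ consists of those real numbers $B$ with $0<B<1$ for which there exist a number $x_2(B)$ and a positive integer $D_B$ such that for every $x\geq x_2(B)$ there is a set $\mathcal{D}_B(x)$ of at most $D_B$ integers, each exceeding $\log x$, with the following property: whenever $y$ is real, $a,d$ are integers with $(a,d)=1$, $1\leq d\leq\min\{x^B,\,y/x^{1-B}\}$, and $d$ is not divisible by any member of $\mathcal{D}_B(x)$, one has $\pi(y;d,a)\geq \frac{\pi(y)}{2\varphi(d)}$. *)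

theory Defs
  imports
    Complex_Main
    "HOL-Computational_Algebra.Computational_Algebra"
    "HOL-Number_Theory.Number_Theory"
begin

definition prime_pi :: "real \<Rightarrow> nat" where
  "prime_pi y = card {p::nat. prime p \<and> real p \<le> y}"

definition prime_pi_ap :: "real \<Rightarrow> nat \<Rightarrow> int \<Rightarrow> nat" where
  "prime_pi_ap y d a = card {p::nat. prime p \<and> real p \<le> y \<and> [int p = a] (mod (int d))}"

definition omega :: "int \<Rightarrow> nat" where
  "omega n = card (prime_factors (nat \<bar>n\<bar>))"

text \<open>
  \<open>associated B D\<close> says that the positive integer \<open>D\<close> can serve as \<open>D\<^sub>B\<close>. The exceptional set
  depends on \<open>x\<close> only: it is chosen before \<open>y\<close>, \<open>a\<close> and \<open>d\<close>.
\<close>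

definition associated :: "real \<Rightarrow> nat \<Rightarrow> bool" where
  "associated B D \<longleftrightarrow>
     D > 0 \<and>
     (\<exists>x2::real. \<forall>x\<ge>x2. \<exists>E::int set.
        finite E \<and> card E \<le> D \<and> (\<forall>m\<in>E. real_of_int m > ln x) \<and>
        (\<forall>(y::real) (a::int) (d::nat).
           coprime a (int d) \<longrightarrow>
           1 \<le> d \<longrightarrow>
           real d \<le> min (x powr B) (y / x powr (1 - B)) \<longrightarrow>
           (\<forall>m\<in>E. \<not> m dvd int d) \<longrightarrow>
           real (prime_pi_ap y d a) \<ge> real (prime_pi y) / (2 * real (totient d))))"

definition calB :: "real set" where
  "calB = {B. 0 < B \<and> B < 1 \<and> (\<exists>D. associated B D)}"

end

theory Submission
  imports Defs "HOL-Analysis.Harmonic_Numbers" "HOL-Real_Asymp.Real_Asymp"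
begin

text \<open>
  Choosing one prime factor of each exceptional modulus and all primes dividing \<open>a\<close>, one gets a set
  of at most \<open>D + omega a\<close> primes; the divisors \<open>d \<le> x powr B\<close> of \<open>L\<close> avoiding them make up a
  proportion at least \<open>2 powr (- D - omega a)\<close> of all. With \<open>X = x powr (1 - B)\<close>, each such \<open>d\<close> has many primes
  \<open>p = d * k + a \<le> d * X\<close>, by the hypothesis on \<open>B\<close> and Chebyshev's lower bound for \<open>prime_pi\<close>.
  Those with a common prime factor \<open>q\<close> of \<open>k\<close> and \<open>L\<close> lie in a residue class modulo \<open>d * q\<close>; by the
  Brun--Titchmarsh inequality, proved with Selberg's sieve, and since \<open>\<Sum> 1 / q\<close> is small, they are a minority.
  So every \<open>d\<close> has at least \<open>(X + \<bar>a\<bar>) / (8 * ln x)\<close> admissible \<open>k \<le> X + \<bar>a\<bar>\<close>, and by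
  pigeonhole some \<open>k\<close> serves a proportion \<open>1 / (8 * ln x)\<close> of the \<open>d\<close>.

  The constants fit because \<open>(2 / 3) / 2 - 3 * (33 / 32) / 16 > 1 / 8\<close>: the factor \<open>2 / 3 < ln 2\<close> is from Chebyshev,
  \<open>3\<close> is the sieve constant, and \<open>33 / 32\<close> bounds \<open>q / (q - 1)\<close>, as every prime \<open>q\<close> dividing \<open>L\<close> exceeds \<open>32\<close>.
\<close>

subsection \<open>Chebyshev's lower bound\<close>

text \<open>The denominators of Leibniz's harmonic triangle; \<open>A\<close>, \<open>B\<close>, \<open>C\<close> below satisfy
  \<open>1 / C = 1 / A - 1 / B\<close>.\<close>

lemma Suc_times_binomial_dvd_common_multiple:
  fixes n k P :: nat
  assumes "k \<le> n" and "\<And>i. 1 \<le> i \<Longrightarrow> i \<le> Suc n \<Longrightarrow> i dvd P"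
  shows "Suc n * (n choose k) dvd P"
  using assms
proof (induction k arbitrary: n)
  case 0
  then show ?case by simp
next
  case (Suc k m)
  then obtain n where m: "m = Suc n" by (cases m) auto
  define A where "A = int (Suc n * (n choose k))"
  define B where "B = int (Suc (Suc n) * (Suc n choose k))"
  define C where "C = int (Suc (Suc n) * (Suc n choose Suc k))"
  have "Suc n * (n choose k) dvd P"
    using Suc.prems m by (intro Suc.IH) auto
  then obtain u where u: "int P = A * u"
    unfolding A_def by (metis dvd_def int_dvd_int_iff)
  have "Suc (Suc n) * (Suc n choose k) dvd P"
    using Suc.prems m by (intro Suc.IH) auto
  then obtain v where v: "int P = B * v"
    unfolding B_def by (metis dvd_def int_dvd_int_iff)
  have A1: "A = int (Suc n choose Suc k) * (int k + 1)"
    unfolding A_def Suc_times_binomial_eq by (simp only: of_nat_mult of_nat_Suc add.commute)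
  have "(Suc n - k) * (Suc n choose k) = Suc n * (n choose k)"
    using binomial_absorb_comp[of "Suc n" k] by simp
  then have A2: "A = (int n + 1 - int k) * int (Suc n choose k)"
    unfolding A_def using Suc.prems(1) m by (metis Suc_le_mono add.commute le_SucI of_nat_Suc of_nat_diff of_nat_mult)
  have "B - A = (int k + 1) * int (Suc n choose k)"
    unfolding A2 B_def by (simp add: algebra_simps)
  then have key: "A * B = C * (B - A)"
    unfolding C_def B_def A1 of_nat_mult by (simp only: mult_ac)
  have "A > 0" "B > 0"
    unfolding A_def B_def using Suc.prems(1) m
    by (simp_all only: of_nat_0_less_iff nat_0_less_mult_iff zero_less_Suc zero_less_binomial_iff simp_thms)
  \<comment> \<open>Divided by \<open>A * B * C\<close> this reads
    \<open>P / C = P / A - P / B = u - v\<close>; because of the differences it is carried out in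
    \<open>int\<close>.\<close>
  have "(A * B) * int P = C * (B * int P - A * int P)"
    by (simp add: key algebra_simps)
  also have "\<dots> = C * (B * (A * u) - A * (B * v))"
    using u v by simp
  also have "\<dots> = (A * B) * (C * (u - v))"
    by (simp add: algebra_simps)
  finally have "int P = C * (u - v)"
    using \<open>A > 0\<close> \<open>B > 0\<close> by simp
  then have "C dvd int P" by simp
  then show ?case unfolding C_def m int_dvd_int_iff .
qed

text \<open>Two estimates of the least common multiple of \<open>1, ..., n\<close>. Every prime
  power exactly dividing it is at most \<open>n\<close>, which bounds it from above by the
  right-hand side. It is divisible by \<open>n\<close> times a middle binomial coefficient of row
  \<open>n - 1\<close>, which bounds it from below by the row sum.\<close>

lemma two_power_le_power_card_primes:
  fixes n :: nat
  assumes "n \<ge> 1"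
  shows "2 ^ (n - 1) \<le> n ^ card {p. prime p \<and> p \<le> n}"
proof -
  have "\<exists>e. \<forall>p::nat. prime p \<longrightarrow> p ^ e p \<le> n \<and> n < p ^ (e p + 1)"
    using ex_power_ivl1[OF prime_ge_2_nat assms] by metis
  then obtain e where e: "\<And>p::nat. prime p \<Longrightarrow> p ^ e p \<le> n \<and> n < p ^ (e p + 1)"
    by blast
  define A where "A = {p::nat. prime p \<and> p \<le> n}"
  \<comment> \<open>As \<open>e p\<close> is the largest exponent with \<open>p ^ e p <= n\<close>,
    this is the least common multiple of \<open>1, ..., n\<close>.\<close>
  define P where "P = (\<Prod>p\<in>A. p ^ e p)"
  have fin: "finite A" unfolding A_def by simp
  have "P > 0" unfolding P_def A_def by (auto intro!: prod_pos prime_gt_0_nat)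
  have dvd: "i dvd P" if "1 \<le> i" "i \<le> n" for i
  proof (rule multiplicity_le_imp_dvd)
    fix q :: nat assume q: "prime q"
    have "q ^ multiplicity q i \<le> i"
      using that by (intro dvd_imp_le multiplicity_dvd) auto
    then have "q ^ multiplicity q i < q ^ (e q + 1)"
      using e[OF q] that by linarith
    then have "multiplicity q i < e q + 1"
      by (rule power_less_imp_less_exp[OF prime_gt_1_nat[OF q]])
    then have le: "multiplicity q i \<le> e q" by simp
    show "multiplicity q i \<le> multiplicity q P"
    proof (cases "q \<le> n")
      case True
      then have "q ^ e q dvd P"
        unfolding P_def using q fin by (intro dvd_prodI) (auto simp: A_def)
      then have "e q \<le> multiplicity q P"
        using \<open>P > 0\<close> q by (intro multiplicity_geI) auto
      with le show ?thesis by simp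
    next
      case False
      then have "\<not> q dvd i" using that by (auto dest: dvd_imp_le)
      then show ?thesis by (simp add: not_dvd_imp_multiplicity_0)
    qed
  qed (use that in auto)
  define N where "N = n - 1"
  have n: "n = Suc N" using assms N_def by simp
  \<comment> \<open>Row \<open>N = n - 1\<close> has \<open>n\<close> entries, none above the middle
    one, and \<open>n\<close> times the middle one is a Leibniz denominator.\<close>
  have "2 ^ N = (\<Sum>k\<le>N. N choose k)"
    by (rule choose_row_sum [symmetric])
  also have "\<dots> \<le> (\<Sum>k\<le>N. N choose (N div 2))"
    by (intro sum_mono binomial_maximum)
  also have "\<dots> = n * (N choose (N div 2))"
    by (simp add: n)
  also have "\<dots> \<le> P"
    using Suc_times_binomial_dvd_common_multiple[of "N div 2" N P] dvd \<open>P > 0\<close>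
    by (intro dvd_imp_le) (auto simp: n)
  also have "P \<le> (\<Prod>p\<in>A. n)"
    unfolding P_def using e by (intro prod_mono) (auto simp: A_def)
  also have "\<dots> = n ^ card A" by simp
  finally show ?thesis unfolding A_def N_def .
qed

text \<open>The logarithm of the preceding bound at the integer part of \<open>y\<close>. Rounding
  loses one and the exponent \<open>n - 1\<close> another, hence \<open>y - 2\<close>; the constant
  comes from \<open>ln 2 >= 2 / 3\<close>.\<close>

lemma prime_pi_lower_bound:
  fixes y :: real
  assumes "y \<ge> 2"
  shows "real (prime_pi y) * ln y \<ge> 2 / 3 * (y - 2)"
proof -
  define n where "n = nat \<lfloor>y\<rfloor>"
  have n: "real n \<le> y" "y < real n + 1" "n \<ge> 1"
    using assms unfolding n_def by linarith+
  have "{p::nat. prime p \<and> real p \<le> y} = {p. prime p \<and> p \<le> n}"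
    using assms by (auto simp: n_def le_nat_floor le_nat_iff le_floor_iff)
  then have pi: "prime_pi y = card {p::nat. prime p \<and> p \<le> n}"
    unfolding prime_pi_def by simp
  have "real (2 ^ (n - 1)) \<le> real (n ^ prime_pi y)"
    unfolding pi using two_power_le_power_card_primes[OF n(3)] of_nat_mono by blast
  then have "ln (2 ^ (n - 1)) \<le> ln (real n ^ prime_pi y)"
    using n by (subst ln_le_cancel_iff) auto
  then have "(real n - 1) * ln 2 \<le> real (prime_pi y) * ln (real n)"
    using n by (simp add: ln_realpow of_nat_diff)
  also have "\<dots> \<le> real (prime_pi y) * ln y"
    using n by (intro mult_left_mono) auto
  finally have "(real n - 1) * ln 2 \<le> real (prime_pi y) * ln y" .
  moreover have "2 / 3 * (y - 2) \<le> ln 2 * (real n - 1)"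
    using n assms ln2_ge_two_thirds by (intro mult_mono) auto
  ultimately show ?thesis by (simp add: mult.commute)
qed

subsection \<open>Selberg's sieve\<close>

text \<open>This is the Moebius function on squarefree numbers only.\<close>

definition mu :: "nat \<Rightarrow> real" where
  "mu n = (-1) ^ card (prime_factors n)"

lemma mu_mult_prime:
  assumes "prime p" and "\<not> p dvd r" and "r > 0"
  shows "mu (p * r) = - mu r"
proof -
  have "prime_factors (p * r) = insert p (prime_factors r)"
    using assms(3) prime_gt_0_nat[OF assms(1)] by (simp add: prime_factors_product prime_prime_factors[OF assms(1)])
  moreover have "p \<notin> prime_factors r" using assms by auto
  ultimately show ?thesis by (simp add: mu_def)
qed

lemma mu_squared [simp]: "mu n ^ 2 = 1"
  by (cases "even (card (prime_factors n))") (auto simp: mu_def)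

lemma abs_mu [simp]: "\<bar>mu n\<bar> = 1"
  by (cases "even (card (prime_factors n))") (auto simp: mu_def)

text \<open>Moebius inversion between \<open>t\<close> and \<open>s\<close>. If \<open>t\<close> is
  a proper divisor, take a prime \<open>p\<close> dividing \<open>s div t\<close>: multiplication by
  \<open>p\<close> pairs the \<open>r\<close> prime to \<open>p\<close> with the others and changes
  the sign of \<open>mu\<close>, so all terms cancel.\<close>

lemma sum_mu_between:
  assumes s: "squarefree s" "s > 0" and ts: "t dvd s"
  shows "(\<Sum>r | t dvd r \<and> r dvd s. mu r) = (if t = s then mu s else 0)"
proof (cases "t = s")
  case True
  then have "{r. t dvd r \<and> r dvd s} = {s}" by (auto intro: dvd_antisym)
  then show ?thesis using True by simp
next
  case False
  obtain c where c: "s = t * c" using ts by blast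
  with False have "c \<noteq> 1" by auto
  then obtain p where p: "prime p" "p dvd c" using prime_factor_nat by blast
  have sq: "\<not> p * p dvd s"
    using s(1) p(1) by (auto simp: squarefree_def power2_eq_square dest: prime_gt_1_nat)
  have pt: "\<not> p dvd t"
    using sq c p(2) by (metis mult_dvd_mono)
  define U where "U = {r. t dvd r \<and> r dvd s \<and> \<not> p dvd r}"
  have fin: "finite {r. t dvd r \<and> r dvd s}"
    using s(2) by (auto intro: finite_subset[OF _ finite_divisors_nat])
  have finU: "finite U"
    by (rule finite_subset[OF _ fin]) (auto simp: U_def)
  have "{r. t dvd r \<and> r dvd s} = U \<union> (\<lambda>r. p * r) ` U"
  proof (intro equalityI subsetI)
    fix r assume r: "r \<in> {r. t dvd r \<and> r dvd s}"
    show "r \<in> U \<union> (\<lambda>r. p * r) ` U"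
    proof (cases "p dvd r")
      case True
      then obtain u where u: "r = p * u" by blast
      have "coprime t p" using pt p(1) by (simp add: prime_imp_coprime coprime_commute)
      then have "t dvd u" using r u by (simp add: coprime_dvd_mult_right_iff)
      moreover have "\<not> p dvd u"
        using sq r u by (metis dvd_trans mem_Collect_eq mult_dvd_mono dvd_refl)
      moreover have "u dvd s" using r u by (auto dest: dvd_mult_right)
      ultimately show ?thesis using u by (auto simp: U_def)
    qed (use r in \<open>auto simp: U_def\<close>)
  next
    fix r assume "r \<in> U \<union> (\<lambda>r. p * r) ` U"
    moreover have "p * u dvd s" if "u \<in> U" for u
      using that p c by (intro divides_mult) (auto simp: U_def prime_imp_coprime)
    ultimately show "r \<in> {r. t dvd r \<and> r dvd s}"
      by (auto simp: U_def)
  qed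
  moreover have "U \<inter> (\<lambda>r. p * r) ` U = {}" by (auto simp: U_def)
  moreover have "(\<Sum>r\<in>(\<lambda>r. p * r) ` U. mu r) = (\<Sum>r\<in>U. mu (p * r))"
    using p(1) by (subst sum.reindex) (auto simp: inj_on_def prime_gt_0_nat)
  moreover have "(\<Sum>r\<in>U. mu (p * r)) = (\<Sum>r\<in>U. - mu r)"
    using s(2) p(1) by (intro sum.cong mu_mult_prime) (auto simp: U_def intro: Nat.gr0I)
  ultimately show ?thesis
    using False finU by (simp add: sum.union_disjoint sum_negf)
qed

text \<open>The support of the sieve weights. Moduli sharing a factor with \<open>m\<close> are left
  out because the values \<open>m * j + a\<close> are not equidistributed modulo them.\<close>

definition selberg_set :: "nat \<Rightarrow> nat \<Rightarrow> nat set" where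
  "selberg_set R m = {s \<in> {1..R}. squarefree s \<and> coprime s m}"

definition selberg_sum :: "nat \<Rightarrow> nat \<Rightarrow> real" where
  "selberg_sum R m = (\<Sum>s\<in>selberg_set R m. 1 / real (totient s))"

text \<open>Selberg's optimal weights: among weights on \<open>selberg_set R m\<close> with value
  \<open>1\<close> at \<open>1\<close>, they minimise the quadratic form evaluated in
  \<open>selberg_quadratic_form\<close>.\<close>

definition selberg_weight :: "nat \<Rightarrow> nat \<Rightarrow> nat \<Rightarrow> real" where
  "selberg_weight R m r =
     mu r * real r / selberg_sum R m * (\<Sum>s | s \<in> selberg_set R m \<and> r dvd s. 1 / real (totient s))"

lemma finite_selberg_set [simp, intro]: "finite (selberg_set R m)"
  by (simp add: selberg_set_def)

lemma selberg_set_dvd: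
  assumes "s \<in> selberg_set R m" and "r dvd s"
  shows "r \<in> selberg_set R m"
proof -
  have s: "s > 0" "s \<le> R" "squarefree s" "coprime s m"
    using assms(1) by (auto simp: selberg_set_def)
  have "r > 0" using assms(2) s(1) by (rule dvd_pos_nat[rotated])
  moreover have "r \<le> R" using dvd_imp_le[OF assms(2) s(1)] s(2) by simp
  moreover have "squarefree r" using assms(2) s(3) by (rule squarefree_mono)
  moreover have "coprime r m" using assms(2) s(4) by (meson coprime_divisors dvd_refl)
  ultimately show ?thesis by (simp add: selberg_set_def)
qed

lemma selberg_set_pos: "s \<in> selberg_set R m \<Longrightarrow> s > 0"
  by (auto simp: selberg_set_def)

lemma selberg_sum_pos:
  assumes "R \<ge> 1"
  shows "selberg_sum R m > 0"
proof -
  have "1 \<in> selberg_set R m" using assms by (simp add: selberg_set_def)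
  then show ?thesis unfolding selberg_sum_def
    by (intro sum_pos) (auto dest: selberg_set_pos)
qed

lemma selberg_weight_1:
  assumes "R \<ge> 1"
  shows "selberg_weight R m 1 = 1"
  using selberg_sum_pos[OF assms, of m]
  by (simp add: selberg_weight_def selberg_sum_def mu_def)

text \<open>The weights are themselves sums over multiples. After exchanging the two summations,
  \<open>sum_mu_between\<close> leaves only \<open>s = t\<close>. These sums are the coordinates in
  which the quadratic form becomes diagonal.\<close>

lemma sum_selberg_weight_multiples:
  assumes t: "t \<in> selberg_set R m"
  shows "(\<Sum>r | r \<in> selberg_set R m \<and> t dvd r. selberg_weight R m r / real r) =
         mu t / (selberg_sum R m * real (totient t))"
proof -
  define S where "S = selberg_set R m"
  define G where "G = selberg_sum R m"
  have [simp]: "finite S" by (simp add: S_def)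
  have "(\<Sum>r | r \<in> S \<and> t dvd r. selberg_weight R m r / real r) =
        (\<Sum>r | r \<in> S \<and> t dvd r. \<Sum>s | s \<in> S \<and> r dvd s. mu r / (G * real (totient s)))"
  proof (intro sum.cong refl)
    fix r assume "r \<in> {r. r \<in> S \<and> t dvd r}"
    then have "r > 0" by (auto simp: S_def dest: selberg_set_pos)
    then have "selberg_weight R m r / real r =
        mu r / G * (\<Sum>s | s \<in> S \<and> r dvd s. 1 / real (totient s))"
      by (simp add: selberg_weight_def S_def G_def)
    then show "selberg_weight R m r / real r = (\<Sum>s | s \<in> S \<and> r dvd s. mu r / (G * real (totient s)))"
      by (simp add: sum_distrib_left)
  qed
  also have "\<dots> = (\<Sum>s | s \<in> S \<and> t dvd s. \<Sum>r | t dvd r \<and> r dvd s. mu r / (G * real (totient s)))"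
  proof -
    let ?h = "\<lambda>r s. mu r / (G * real (totient s))"
    have "(\<Sum>r | r \<in> S \<and> t dvd r. \<Sum>s | s \<in> S \<and> r dvd s. ?h r s) =
          (\<Sum>r | r \<in> S \<and> t dvd r. \<Sum>s | s \<in> {s. s \<in> S \<and> t dvd s} \<and> r dvd s. ?h r s)"
      by (intro sum.cong refl) (auto intro: dvd_trans)
    also have "\<dots> = (\<Sum>s | s \<in> S \<and> t dvd s. \<Sum>r | r \<in> {r. r \<in> S \<and> t dvd r} \<and> r dvd s. ?h r s)"
      by (rule sum.swap_restrict) auto
    also have "\<dots> = (\<Sum>s | s \<in> S \<and> t dvd s. \<Sum>r | t dvd r \<and> r dvd s. ?h r s)"
      by (intro sum.cong refl) (auto simp: S_def intro: selberg_set_dvd)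
    finally show ?thesis .
  qed
  also have "\<dots> = (\<Sum>s | s \<in> S \<and> t dvd s. (if t = s then mu s else 0) / (G * real (totient s)))"
  proof (intro sum.cong refl)
    fix s assume "s \<in> {s. s \<in> S \<and> t dvd s}"
    then have "squarefree s" "s > 0" "t dvd s"
      by (auto simp: S_def selberg_set_def)
    from sum_mu_between[OF this]
    show "(\<Sum>r | t dvd r \<and> r dvd s. mu r / (G * real (totient s))) =
          (if t = s then mu s else 0) / (G * real (totient s))"
      by (simp flip: sum_divide_distrib)
  qed
  also have "\<dots> = (\<Sum>s | s \<in> S \<and> t dvd s. if s = t then mu t / (G * real (totient t)) else 0)"
    by (intro sum.cong) auto
  also have "\<dots> = mu t / (G * real (totient t))"
    using t by (simp add: S_def)
  finally show ?thesis by (simp add: S_def G_def)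
qed

text \<open>The weights diagonalise the quadratic form because \<open>gcd r r' = (\<Sum>t | t dvd r \<and> t dvd r'. totient t)\<close>.\<close>

lemma selberg_quadratic_form:
  assumes "R \<ge> 1"
  shows "(\<Sum>r\<in>selberg_set R m. \<Sum>r'\<in>selberg_set R m.
           selberg_weight R m r * selberg_weight R m r' / real (lcm r r')) = 1 / selberg_sum R m"
proof -
  define S where "S = selberg_set R m"
  define G where "G = selberg_sum R m"
  define f where "f r = selberg_weight R m r / real r" for r
  have fin [simp]: "finite S" by (simp add: S_def)
  have G: "G > 0" using selberg_sum_pos[OF assms] by (simp add: G_def)
  have "selberg_weight R m r * selberg_weight R m r' / real (lcm r r') =
        (\<Sum>t\<in>S. real (totient t) * ((of_bool (t dvd r) * f r) * (of_bool (t dvd r') * f r')))"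
    if r: "r \<in> S" "r' \<in> S" for r r'
  proof -
    have pos: "r > 0" "r' > 0" using r by (auto simp: S_def selberg_set_pos)
    have "real (lcm r r') * real (gcd r r') = real r * real r'"
      by (metis of_nat_mult mult.commute prod_gcd_lcm_nat)
    moreover have "real (lcm r r') > 0" using pos by (simp add: lcm_pos_nat)
    ultimately have "selberg_weight R m r * selberg_weight R m r' / real (lcm r r') =
        real (gcd r r') * (f r * f r')"
      using pos by (simp add: f_def field_simps)
    also have "real (gcd r r') = (\<Sum>t | t dvd gcd r r'. real (totient t))"
      by (metis of_nat_sum totient_divisor_sum)
    also have "{t. t dvd gcd r r'} = {t \<in> S. t dvd r \<and> t dvd r'}"
      using r by (auto simp: S_def intro: selberg_set_dvd)
    also have "(\<Sum>t\<in>\<dots>. real (totient t)) = (\<Sum>t\<in>S. if t dvd r \<and> t dvd r' then real (totient t) else 0)"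
      by (simp add: sum.inter_filter)
    also have "\<dots> * (f r * f r') =
        (\<Sum>t\<in>S. real (totient t) * ((of_bool (t dvd r) * f r) * (of_bool (t dvd r') * f r')))"
      unfolding sum_distrib_right by (intro sum.cong) auto
    finally show ?thesis .
  qed
  then have "(\<Sum>r\<in>S. \<Sum>r'\<in>S. selberg_weight R m r * selberg_weight R m r' / real (lcm r r')) =
     (\<Sum>r\<in>S. \<Sum>r'\<in>S. \<Sum>t\<in>S. real (totient t) * ((of_bool (t dvd r) * f r) * (of_bool (t dvd r') * f r')))"
    by (intro sum.cong) auto
  also have "\<dots> = (\<Sum>r\<in>S. \<Sum>t\<in>S. \<Sum>r'\<in>S. real (totient t) * ((of_bool (t dvd r) * f r) * (of_bool (t dvd r') * f r')))"
    by (intro sum.cong refl sum.swap)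
  also have "\<dots> = (\<Sum>t\<in>S. \<Sum>r\<in>S. \<Sum>r'\<in>S. real (totient t) * ((of_bool (t dvd r) * f r) * (of_bool (t dvd r') * f r')))"
    by (rule sum.swap)
  \<comment> \<open>For fixed \<open>t\<close> the double sum is a square, in which the sign
    \<open>mu t\<close> disappears; the whole then collapses to \<open>G / G ^ 2\<close>.\<close>
  also have "\<dots> = (\<Sum>t\<in>S. real (totient t) * (\<Sum>r\<in>S. of_bool (t dvd r) * f r) ^ 2)"
    unfolding power2_eq_square sum_product by (simp only: sum_distrib_left)
  also have "\<dots> = (\<Sum>t\<in>S. 1 / real (totient t) / G ^ 2)"
  proof (intro sum.cong refl)
    fix t assume t: "t \<in> S"
    have "(\<Sum>r\<in>S. of_bool (t dvd r) * f r) = (\<Sum>r\<in>S. if t dvd r then f r else 0)"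
      by (intro sum.cong) auto
    also have "\<dots> = (\<Sum>r | r \<in> S \<and> t dvd r. f r)"
      by (rule sum.inter_filter [OF fin, symmetric])
    also have "\<dots> = mu t / (G * real (totient t))"
      using sum_selberg_weight_multiples[of t R m] t by (simp add: S_def G_def f_def)
    finally have "(\<Sum>r\<in>S. of_bool (t dvd r) * f r) = mu t / (G * real (totient t))" .
    moreover have "totient t > 0" using t by (simp add: S_def selberg_set_pos)
    ultimately show "real (totient t) * (\<Sum>r\<in>S. of_bool (t dvd r) * f r) ^ 2 = 1 / real (totient t) / G ^ 2"
      using G by (simp add: power_divide power_mult_distrib power2_eq_square[of "real (totient t)"])
  qed
  also have "\<dots> = (\<Sum>t\<in>S. 1 / real (totient t)) / G ^ 2"
    by (simp add: sum_divide_distrib)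
  also have "(\<Sum>t\<in>S. 1 / real (totient t)) = G"
    by (simp add: S_def G_def selberg_sum_def)
  also have "G / G ^ 2 = 1 / G"
    using G by (simp add: power2_eq_square)
  finally show ?thesis by (simp add: S_def G_def)
qed

section \<open>Lower bound for the Selberg sum\<close>

lemma prime_factors_prod_primes:
  assumes "finite A" and "\<And>p. p \<in> A \<Longrightarrow> prime (p::nat)"
  shows "prime_factors (\<Prod>A) = A"
proof -
  have "0 \<notin> A" using assms(2) by force
  then have "prime_factors (prod (\<lambda>x. x) A) = (\<Union>p\<in>A. prime_factors p)"
    using assms(1) by (subst prime_factors_prod) auto
  also have "\<dots> = A" using assms(2) by (auto simp: prime_prime_factors)
  finally show ?thesis .
qed

lemma squarefree_prod_primes:
  assumes "\<And>p. p \<in> A \<Longrightarrow> prime (p::nat)"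
  shows "squarefree (\<Prod>A)"
  by (rule squarefree_prod_coprime) (use assms in \<open>auto simp: primes_coprime squarefree_prime\<close>)

text \<open>Each factor is a geometric series over the positive exponents of \<open>p\<close>, the
  shape in which it comes out of the truncated Euler product.\<close>

lemma totient_prod_primes:
  assumes "finite A" and "\<And>p. p \<in> A \<Longrightarrow> prime (p::nat)"
  shows "1 / real (totient (\<Prod>A)) = (\<Prod>p\<in>A. (1 / real p) / (1 - 1 / real p))"
proof -
  have "real (totient (\<Prod>A)) = real (\<Prod>A) * (\<Prod>p\<in>A. 1 - 1 / real p)"
    by (subst totient_formula2) (simp only: prime_factors_prod_primes[OF assms])
  also have "\<dots> = (\<Prod>p\<in>A. real p * (1 - 1 / real p))"
    by (simp add: prod.distrib)
  finally show ?thesis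
    by (simp add: prod_dividef [symmetric] prod_inversef [symmetric] divide_inverse prod.distrib)
qed

lemma self_div_totient:
  assumes "n > 0"
  shows "real n / real (totient n) = (\<Prod>p\<in>prime_factors n. 1 / (1 - 1 / real p))"
  using assms by (subst totient_formula2) (simp add: prod_dividef)

text \<open>A finite truncation of the Euler product: the primes in \<open>A\<close> occur with positive exponent,
  those in \<open>P - A\<close> with arbitrary exponent.\<close>

lemma sum_inverse_le_euler_product:
  fixes P A :: "nat set"
  assumes "finite P" and "\<And>p. p \<in> P \<Longrightarrow> prime p" and "finite T" and "A \<subseteq> P"
    and "\<And>n. n \<in> T \<Longrightarrow> n > 0 \<and> A \<subseteq> prime_factors n \<and> prime_factors n \<subseteq> P"
  shows "(\<Sum>n\<in>T. 1 / real n) \<le>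
         (\<Prod>p\<in>P. if p \<in> A then (1 / real p) / (1 - 1 / real p) else 1 / (1 - 1 / real p))"
  using assms
proof (induction P arbitrary: T A rule: finite_induct)
  case empty
  then have "T \<subseteq> {1}" by (force simp: prime_factorization_empty_iff)
  then have "(\<Sum>n\<in>T. 1 / real n) \<le> (\<Sum>n\<in>{1::nat}. 1 / real n)"
    by (intro sum_mono2) auto
  then show ?case by simp
next
  case (insert p P)
  define x where "x = 1 / real p"
  have p: "prime p" using insert.prems by auto
  then have x: "0 < x" "x < 1" using prime_gt_1_nat[OF p] by (auto simp: x_def)
  define w where "w A q = (if q \<in> A then (1 / real q) / (1 - 1 / real q) else 1 / (1 - 1 / real q))" for A and q :: nat
  \<comment> \<open>The inserted \<open>0\<close> makes the maximum meaningful for empty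
    \<open>T\<close>.\<close>
  define K where "K = Max (insert 0 (multiplicity p ` T))"
  define E where "E = (if p \<in> A then {1..K} else {0..K})"
  define c where "c n = n div p ^ multiplicity p n" for n
  have n_eq: "n = p ^ multiplicity p n * c n" for n
    unfolding c_def by (simp add: multiplicity_dvd)
  have pf: "prime_factors (c n) = prime_factors n - {p}" and cpos: "c n > 0" if "n > 0" for n
  proof -
    show *: "c n > 0" using that n_eq[of n] by (metis Nat.gr0I mult_0_right)
    have "\<not> p dvd c n"
      unfolding c_def using that p by (intro multiplicity_decompose) auto
    moreover have "prime_factors n = prime_factors (p ^ multiplicity p n) \<union> prime_factors (c n)"
      using * p by (subst n_eq, subst prime_factors_product) (auto simp: prime_gt_0_nat)
    moreover have "prime_factors (p ^ multiplicity p n) \<subseteq> {p}"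
      using p by (auto simp: prime_factors_dvd dest: prime_dvd_power primes_dvd_imp_eq)
    ultimately show "prime_factors (c n) = prime_factors n - {p}" by auto
  qed
  have inj: "inj_on (\<lambda>n. (multiplicity p n, c n)) T"
    by (rule inj_onI) (metis n_eq prod.inject)
  have sub: "(\<lambda>n. (multiplicity p n, c n)) ` T \<subseteq> E \<times> c ` T"
  proof safe
    fix n assume n: "n \<in> T"
    then have "multiplicity p n \<le> K"
      unfolding K_def using insert.prems by (intro Max_ge) auto
    moreover have "multiplicity p n \<ge> 1" if "p \<in> A"
      using that insert.prems(4)[OF n] by (auto simp: prime_factors_multiplicity)
    ultimately show "multiplicity p n \<in> E" by (auto simp: E_def)
  qed auto
  have "(\<Sum>n\<in>T. 1 / real n) = (\<Sum>n\<in>T. x ^ multiplicity p n * (1 / real (c n)))"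
    by (intro sum.cong refl, subst n_eq) (simp add: x_def power_one_over del: of_nat_power)
  also have "\<dots> = (\<Sum>(e, k)\<in>(\<lambda>n. (multiplicity p n, c n)) ` T. x ^ e * (1 / real k))"
    by (subst sum.reindex[OF inj]) simp
  \<comment> \<open>Enlarging the set of pairs to a full product only adds nonnegative terms and
    lets the sum factor.\<close>
  also have "\<dots> \<le> (\<Sum>(e, k)\<in>E \<times> c ` T. x ^ e * (1 / real k))"
    using sub x insert.prems by (intro sum_mono2) (auto simp: E_def)
  also have "\<dots> = (\<Sum>e\<in>E. x ^ e) * (\<Sum>k\<in>c ` T. 1 / real k)"
    by (simp add: sum.cartesian_product sum_product)
  also have "\<dots> \<le> w A p * (\<Prod>q\<in>P. w (A - {p}) q)"
  proof (rule mult_mono)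
    have "(\<Sum>e\<in>{0..K}. x ^ e) = (1 - x ^ Suc K) / (1 - x)"
      using x by (simp add: sum_gp)
    moreover have "(1 - x ^ Suc K) / (1 - x) \<le> 1 / (1 - x)"
      using x by (intro divide_right_mono) auto
    ultimately have 0: "(\<Sum>e\<in>{0..K}. x ^ e) \<le> 1 / (1 - x)" by simp
    have "(\<Sum>e\<in>{0..K}. x ^ e) = 1 + (\<Sum>e\<in>{1..K}. x ^ e)"
      by (simp add: sum.atLeast_Suc_atMost)
    moreover have "1 / (1 - x) = 1 + x / (1 - x)" using x by (simp add: field_simps)
    ultimately have "(\<Sum>e\<in>{1..K}. x ^ e) \<le> x / (1 - x)" using 0 by simp
    with 0 show "(\<Sum>e\<in>E. x ^ e) \<le> w A p" by (auto simp: E_def w_def x_def)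
    show "(\<Sum>k\<in>c ` T. 1 / real k) \<le> (\<Prod>q\<in>P. w (A - {p}) q)"
      unfolding w_def
    proof (rule insert.IH)
      fix k assume "k \<in> c ` T"
      then obtain n where n: "n \<in> T" "k = c n" by auto
      then show "k > 0 \<and> A - {p} \<subseteq> prime_factors k \<and> prime_factors k \<subseteq> P"
        using insert.prems(4)[OF n(1)] pf[of n] cpos[of n] by auto
    qed (use insert.prems in auto)
    show "0 \<le> w A p" using x by (auto simp: w_def x_def)
  qed (auto intro: sum_nonneg)
  also have "(\<Prod>q\<in>P. w (A - {p}) q) = (\<Prod>q\<in>P. w A q)"
    using insert.hyps by (intro prod.cong) (auto simp: w_def)
  also have "w A p * (\<Prod>q\<in>P. w A q) = (\<Prod>q\<in>insert p P. w A q)"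
    using insert.hyps by simp
  finally show ?case by (simp add: w_def)
qed

text \<open>The integers \<open>n\<close> up to \<open>R\<close> are grouped by \<open>s n\<close>,
  the product of their primes not dividing \<open>m\<close>. In the group of \<open>t\<close> the
  primes of \<open>t\<close> occur with positive exponent and those of \<open>m\<close> with any
  exponent, so the Euler product bounds its reciprocals by
  \<open>1 / totient t * (m / totient m)\<close>. The sum over all groups is the harmonic
  sum.\<close>

lemma selberg_sum_lower_bound:
  assumes "m > 0"
  shows "ln (real R + 1) \<le> real m / real (totient m) * selberg_sum R m"
proof -
  define A where "A n = prime_factors n - prime_factors m" for n :: nat
  define s where "s n = \<Prod>(A n)" for n
  define S where "S = selberg_set R m"
  have pfs: "prime_factors (s n) = A n" for n
    unfolding s_def by (rule prime_factors_prod_primes) (auto simp: A_def)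
  have sS: "s n \<in> S" if "n \<in> {1..R}" for n
  proof -
    have "s n dvd n"
    proof -
      have "s n dvd \<Prod>(prime_factors n)"
        unfolding s_def A_def by (rule prod_dvd_prod_subset) auto
      also have "\<dots> dvd (\<Prod>p\<in>prime_factors n. p ^ multiplicity p n)"
        by (rule prod_dvd_prod) (auto simp: prime_factors_multiplicity)
      also have "\<dots> = n" using that by (subst prime_factorization_nat[symmetric]) auto
      finally show ?thesis .
    qed
    moreover have "n > 0" using that by simp
    ultimately have "s n > 0" "s n \<le> R"
      using that dvd_pos_nat[of n "s n"] dvd_imp_le[of "s n" n] by auto
    moreover have "squarefree (s n)"
      unfolding s_def by (rule squarefree_prod_primes) (auto simp: A_def)
    moreover have "coprime (s n) m"
    proof (rule ccontr)
      assume "\<not> coprime (s n) m"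
      then obtain p where "prime p" "p dvd s n" "p dvd m"
        by (metis coprime_iff_gcd_eq_1 gcd_nat.boundedE prime_factor_nat)
      then have "p \<in> prime_factors (s n)" "p \<in> prime_factors m"
        using \<open>s n > 0\<close> assms by (auto simp: prime_factors_dvd)
      then show False by (simp add: pfs A_def)
    qed
    ultimately show ?thesis by (simp add: S_def selberg_set_def)
  qed
  have "ln (real R + 1) \<le> harm R" by (rule harm_ge_ln)
  also have "\<dots> = (\<Sum>n\<in>{1..R}. 1 / real n)" by (simp add: harm_def divide_inverse)
  also have "\<dots> = (\<Sum>t\<in>S. \<Sum>n | n \<in> {1..R} \<and> s n = t. 1 / real n)"
    using sS by (intro sum.group [symmetric]) (auto simp: S_def)
  also have "\<dots> \<le> (\<Sum>t\<in>S. 1 / real (totient t) * (real m / real (totient m)))"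
  proof (rule sum_mono)
    fix t assume t: "t \<in> S"
    show "(\<Sum>n | n \<in> {1..R} \<and> s n = t. 1 / real n) \<le> 1 / real (totient t) * (real m / real (totient m))"
    proof (cases "\<exists>n. n \<in> {1..R} \<and> s n = t")
      case True
      then obtain n0 where n0: "s n0 = t" by blast
      define B where "B = prime_factors t"
      have B: "B = A n0" using pfs[of n0] n0 by (simp add: B_def)
      define P where "P = B \<union> prime_factors m"
      have "(\<Sum>n | n \<in> {1..R} \<and> s n = t. 1 / real n) \<le>
         (\<Prod>p\<in>P. if p \<in> B then (1 / real p) / (1 - 1 / real p) else 1 / (1 - 1 / real p))"
      proof (rule sum_inverse_le_euler_product)
        fix n assume n: "n \<in> {n. n \<in> {1..R} \<and> s n = t}"
        then have "B = A n" using pfs[of n] by (auto simp: B_def)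
        then show "0 < n \<and> B \<subseteq> prime_factors n \<and> prime_factors n \<subseteq> P"
          using n by (auto simp: P_def A_def)
      qed (auto simp: P_def B_def)
      also have "\<dots> = (\<Prod>p\<in>B. (1 / real p) / (1 - 1 / real p)) * (\<Prod>p\<in>prime_factors m. 1 / (1 - 1 / real p))"
      proof -
        have disj: "B \<inter> prime_factors m = {}" using B by (auto simp: A_def)
        show ?thesis unfolding P_def
          by (subst prod.union_disjoint)
             (use disj in \<open>auto simp: B_def intro!: arg_cong2[of _ _ _ _ "(*)"] prod.cong\<close>)
      qed
      also have "(\<Prod>p\<in>B. (1 / real p) / (1 - 1 / real p)) = 1 / real (totient (\<Prod>B))"
        by (rule totient_prod_primes [symmetric]) (auto simp: B_def)
      also have "\<Prod>B = t" using n0 by (simp add: B s_def)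
      also have "(\<Prod>p\<in>prime_factors m. 1 / (1 - 1 / real p)) = real m / real (totient m)"
        using self_div_totient[OF assms] by simp
      finally show ?thesis .
    next
      case False
      then have "{n. n \<in> {1..R} \<and> s n = t} = {}" by blast
      then show ?thesis by (simp only: sum.empty) simp
    qed
  qed
  also have "\<dots> = real m / real (totient m) * selberg_sum R m"
    by (simp add: selberg_sum_def S_def sum_distrib_left mult.commute)
  finally show ?thesis .
qed

section \<open>Size of the Selberg weights\<close>

text \<open>In increasing order the elements are at least \<open>2, 3, 4, ...\<close>, so the
  product is at most a telescoping product of factors \<open>(i + 1) / i\<close>. The induction adds
  a new maximum \<open>b\<close>, which is at least \<open>card A + 2\<close>.\<close>

lemma prod_one_minus_inverse_le:
  fixes A :: "nat set"
  assumes "finite A" and "\<And>i. i \<in> A \<Longrightarrow> i \<ge> 2"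
  shows "(\<Prod>i\<in>A. 1 / (1 - 1 / real i)) \<le> real (card A) + 1"
  using assms
proof (induction A rule: finite_linorder_max_induct)
  case empty
  then show ?case by simp
next
  case (insert b A)
  have "A \<subseteq> {2..<b}" using insert by force
  then have "card A \<le> b - 2" using card_mono[of "{2..<b}" A] by simp
  moreover have b: "b \<ge> 2" using insert by simp
  ultimately have cb: "real (card A) + 2 \<le> real b" by linarith
  have "1 / (1 - 1 / real b) = 1 + 1 / (real b - 1)"
    using b by (simp add: field_simps)
  also have "\<dots> \<le> 1 + 1 / (real (card A) + 1)"
    using cb by (intro add_left_mono divide_left_mono) auto
  finally have "1 / (1 - 1 / real b) \<le> 1 + 1 / (real (card A) + 1)" .
  moreover have "(\<Prod>i\<in>A. 1 / (1 - 1 / real i)) \<ge> 0"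
  proof (rule prod_nonneg)
    fix i assume "i \<in> A"
    then have "i \<ge> 2" using insert by auto
    then show "0 \<le> 1 / (1 - 1 / real i)" by simp
  qed
  ultimately have "1 / (1 - 1 / real b) * (\<Prod>i\<in>A. 1 / (1 - 1 / real i)) \<le>
             (1 + 1 / (real (card A) + 1)) * (real (card A) + 1)"
    using insert b by (intro mult_mono) auto
  also have "\<dots> = real (card A) + 2" by (simp add: field_simps)
  finally show ?case using insert by (subst prod.insert) auto
qed

text \<open>A number with \<open>c\<close> distinct prime factors is at least \<open>2 ^ c\<close>,
  and the preceding lemma bounds the Euler product over them by \<open>c + 1\<close>.\<close>

lemma self_div_totient_le:
  assumes "n > 0"
  shows "real n / real (totient n) \<le> ln (real n) / ln 2 + 1"
proof -
  define c where "c = card (prime_factors n)"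
  have "2 ^ c = (\<Prod>p\<in>prime_factors n. 2::nat)" by (simp add: c_def)
  also have "\<dots> \<le> (\<Prod>p\<in>prime_factors n. p ^ multiplicity p n)"
  proof (rule prod_mono)
    fix p assume p: "p \<in> prime_factors n"
    then have "2 \<le> p" by (auto intro: prime_ge_2_nat)
    also have "p \<le> p ^ multiplicity p n"
      using p by (intro self_le_power) (auto simp: prime_factors_multiplicity prime_gt_0_nat Suc_le_eq)
    finally show "0 \<le> (2::nat) \<and> 2 \<le> p ^ multiplicity p n" by simp
  qed
  also have "\<dots> = n" using assms by (subst prime_factorization_nat[symmetric]) auto
  finally have "2 ^ c \<le> real n" by (metis of_nat_le_iff of_nat_numeral of_nat_power)
  then have "ln (2 ^ c) \<le> ln (real n)"
    using assms by (subst ln_le_cancel_iff) auto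
  then have "real c \<le> ln (real n) / ln 2" by (simp add: ln_realpow field_simps)
  moreover have "real n / real (totient n) \<le> real c + 1"
    unfolding self_div_totient[OF assms] c_def
    by (rule prod_one_minus_inverse_le) (auto intro: prime_ge_2_nat)
  ultimately show ?thesis by simp
qed

text \<open>A squarefree multiple of \<open>r\<close> is \<open>r * u\<close> with \<open>u\<close>
  coprime to \<open>r\<close>. Hence the sum in the weight is at most \<open>G / totient r\<close>,
  and the weight at most \<open>r / totient r\<close> in absolute value.\<close>

lemma abs_selberg_weight_le:
  assumes r: "r \<in> selberg_set R m"
  shows "\<bar>selberg_weight R m r\<bar> \<le> ln (real R) / ln 2 + 1"
proof -
  define S where "S = selberg_set R m"
  define G where "G = selberg_sum R m"
  have r0: "r > 0" "r \<le> R" using r by (auto simp: selberg_set_def)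
  then have G: "G > 0" using selberg_sum_pos[of R m] by (simp add: G_def)
  define U where "U = {s. s \<in> S \<and> r dvd s}"
  have fact: "s div r \<in> S \<and> totient s = totient r * totient (s div r)" if "s \<in> U" for s
  proof -
    from that obtain u where u: "s = r * u" by (auto simp: U_def)
    have s: "squarefree s" "s \<in> S" using that by (auto simp: U_def S_def selberg_set_def)
    have "coprime r u"
    proof (rule ccontr)
      assume "\<not> coprime r u"
      then obtain p where "prime p" "p dvd r" "p dvd u"
        by (metis coprime_iff_gcd_eq_1 gcd_nat.boundedE prime_factor_nat)
      then have "p ^ 2 dvd s" by (simp add: u power2_eq_square mult_dvd_mono)
      with s(1) \<open>prime p\<close> show False by (auto dest: squarefreeD)
    qed
    moreover have "u \<in> S" using s(2) u unfolding S_def by (auto intro: selberg_set_dvd)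
    ultimately show ?thesis using u r0 by (simp add: totient_mult_coprime)
  qed
  have "(\<Sum>s\<in>U. 1 / real (totient s)) = (\<Sum>s\<in>U. 1 / real (totient r) * (1 / real (totient (s div r))))"
    using fact by (intro sum.cong) auto
  also have "\<dots> = 1 / real (totient r) * (\<Sum>u\<in>(\<lambda>s. s div r) ` U. 1 / real (totient u))"
    by (subst sum.reindex) (auto simp: U_def inj_on_def dvd_div_eq_iff sum_distrib_left)
  also have "\<dots> \<le> 1 / real (totient r) * G"
    unfolding G_def selberg_sum_def using fact
    by (intro mult_left_mono sum_mono2) (auto simp: S_def)
  finally have le: "(\<Sum>s\<in>U. 1 / real (totient s)) \<le> 1 / real (totient r) * G" .
  have "\<bar>selberg_weight R m r\<bar> = real r / G * (\<Sum>s\<in>U. 1 / real (totient s))"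
    using G by (simp add: selberg_weight_def abs_mult U_def S_def G_def sum_nonneg abs_of_nonneg)
  also have "\<dots> \<le> real r / G * (1 / real (totient r) * G)"
    using le G by (intro mult_left_mono) auto
  also have "\<dots> = real r / real (totient r)" using G by simp
  also have "\<dots> \<le> ln (real r) / ln 2 + 1" by (rule self_div_totient_le[OF r0(1)])
  also have "\<dots> \<le> ln (real R) / ln 2 + 1"
    using r0 by (intro add_right_mono divide_right_mono) auto
  finally show ?thesis .
qed

section \<open>The sieve inequality and the Brun--Titchmarsh bound\<close>

text \<open>Since \<open>m\<close> is invertible modulo \<open>l\<close>, the condition on
  \<open>j\<close> describes a single residue class modulo \<open>l\<close>.\<close>

lemma card_dvd_linear:
  fixes l m N :: nat and a :: int
  assumes "l > 0" and "coprime l m"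
  shows "\<bar>real (card {j \<in> {1..N}. int l dvd int m * int j + a}) - real N / real l\<bar> \<le> 1"
proof -
  have "coprime (int m) (int l)" using assms(2) by (simp add: coprime_commute)
  then obtain x where "[int m * x = 1] (mod int l)"
    using cong_solve_coprime_int by blast
  then have x: "int l dvd int m * x - 1" by (simp add: cong_iff_dvd_diff)
  \<comment> \<open>The class is that of \<open>- a * x\<close>. Subtracting one before
    \<open>mod\<close> and adding it afterwards puts the representative in \<open>1..l\<close>, so
    \<open>c\<close> is the least positive solution.\<close>
  define c where "c = nat ((- a * x - 1) mod int l) + 1"
  have c: "1 \<le> c" "c \<le> l"
    using assms(1) by (auto simp: c_def nat_less_iff Suc_le_eq)
  have "int l dvd int c + a * x"
  proof -
    have "int c = (- a * x - 1) mod int l + 1" using assms(1) by (simp add: c_def)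
    then have "int c + a * x = - ((- a * x - 1) div int l * int l)"
      using minus_mod_eq_div_mult[of "- a * x - 1" "int l"] by simp
    then show ?thesis by simp
  qed
  from dvd_diff[OF dvd_mult[OF this] dvd_mult[OF x]]
  have "int l dvd int m * (int c + a * x) - a * (int m * x - 1)" .
  then have mc: "int l dvd int m * int c + a" by (simp add: algebra_simps)
  have iff: "int l dvd int m * int j + a \<longleftrightarrow> int l dvd int j - int c" for j
  proof -
    have "int l dvd int m * int j + a \<longleftrightarrow> int l dvd (int m * int j + a) - (int m * int c + a)"
      using mc by (simp only: dvd_diff_left_iff)
    also have "(int m * int j + a) - (int m * int c + a) = int m * (int j - int c)"
      by (simp add: algebra_simps)
    also have "int l dvd int m * (int j - int c) \<longleftrightarrow> int l dvd int j - int c"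
      using assms(2) by (simp add: coprime_dvd_mult_right_iff)
    finally show ?thesis .
  qed
  define I where "I = {i. c + l * i \<le> N}"
  have "{j \<in> {1..N}. int l dvd int m * int j + a} = (\<lambda>i. c + l * i) ` I"
  proof (intro equalityI subsetI)
    fix j assume j: "j \<in> {j \<in> {1..N}. int l dvd int m * int j + a}"
    then obtain t where t: "int j - int c = int l * t" using iff by blast
    \<comment> \<open>From \<open>j >= 1\<close> and \<open>c <= l\<close> one gets
      \<open>j - c > - l\<close>, so \<open>t\<close> is not negative.\<close>
    have "int l * (-1) < int l * t" using j c t by auto
    then have "t \<ge> 0" using assms(1) by (simp only: mult_less_cancel_left_pos of_nat_0_less_iff)
    then have "j = c + l * nat t"
      using t by (simp flip: of_nat_eq_iff[where 'a = int])
    then show "j \<in> (\<lambda>i. c + l * i) ` I" using j by (auto simp: I_def)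
  next
    fix j assume "j \<in> (\<lambda>i. c + l * i) ` I"
    then show "j \<in> {j \<in> {1..N}. int l dvd int m * int j + a}"
      using c by (auto simp: I_def iff)
  qed
  then have card: "card {j \<in> {1..N}. int l dvd int m * int j + a} = card I"
    using assms(1) by (simp add: card_image inj_on_def)
  show ?thesis
  proof (cases "c \<le> N")
    case True
    have "I = {..(N - c) div l}"
      using True assms(1) by (auto simp: I_def less_eq_div_iff_mult_less_eq mult.commute)
    then have cardI: "real (card I) = real ((N - c) div l) + 1" by simp
    have "real ((N - c) div l) \<le> real (N - c) / real l"
      by (rule of_nat_div_le_of_nat)
    also have "\<dots> \<le> real N / real l" by (intro divide_right_mono) auto
    finally have up: "real (card I) \<le> real N / real l + 1" using cardI by simp
    have "real (N - c) < real l * (real ((N - c) div l) + 1)"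
      using assms(1) dividend_less_div_times[of l "N - c"]
      by (metis of_nat_Suc of_nat_less_iff of_nat_mult add.commute mult.commute mult_Suc)
    then have "real N < real l * (real ((N - c) div l) + 1) + real l"
      using c True by (simp add: of_nat_diff)
    then have "real N / real l < real (card I) + 1"
      using assms(1) cardI by (simp add: field_simps)
    with up card show ?thesis by simp
  next
    case False
    then have "I = {}" by (auto simp: I_def)
    moreover have "real N / real l \<le> 1" using False c assms(1) by simp
    ultimately show ?thesis unfolding card by simp
  qed
qed

text \<open>If \<open>n j\<close> is a prime above \<open>R\<close>, its only divisor in the set is
  \<open>1\<close>, so the squared sum of the weights at divisors of \<open>n j\<close> equals
  \<open>1\<close>; for other \<open>j\<close> it is nonnegative. Expanding the square gives the
  quadratic form as main term and an error at most \<open>1\<close> times each product of two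
  weights. The prime values up to \<open>R\<close> account for the summand \<open>R\<close>.\<close>

lemma selberg_sieve:
  fixes m N R :: nat and a :: int
  assumes "R \<ge> 1" and "m > 0"
  shows "real (card {j \<in> {1..N}. prime (int m * int j + a)}) \<le>
         real N / selberg_sum R m + (\<Sum>r\<in>selberg_set R m. \<bar>selberg_weight R m r\<bar>) ^ 2 + real R"
proof -
  define S where "S = selberg_set R m"
  define w where "w = selberg_weight R m"
  define n where "n j = int m * int j + a" for j
  define A where "A = {j \<in> {1..N}. prime (n j) \<and> n j > int R}"
  define C where "C = {j \<in> {1..N}. prime (n j) \<and> n j \<le> int R}"
  have fin: "finite S" by (simp add: S_def)
  have "card C \<le> card {1..R}"
  proof (rule card_inj_on_le)
    show "inj_on (\<lambda>j. nat (n j)) C"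
    proof (rule inj_onI)
      fix i j assume "i \<in> C" "j \<in> C" and eq: "nat (n i) = nat (n j)"
      then have "n i > 0" "n j > 0" by (auto simp: C_def intro: prime_gt_0_int)
      with eq have "n i = n j" by simp
      then show "i = j" using assms(2) by (simp add: n_def)
    qed
    show "(\<lambda>j. nat (n j)) ` C \<subseteq> {1..R}"
    proof
      fix k assume "k \<in> (\<lambda>j. nat (n j)) ` C"
      then obtain j where "k = nat (n j)" "n j > 0" "n j \<le> int R"
        by (auto simp: C_def intro: prime_gt_0_int)
      then show "k \<in> {1..R}" by (auto simp: nat_le_iff Suc_le_eq)
    qed
  qed auto
  then have C: "real (card C) \<le> real R" by simp
  have "real (card A) = (\<Sum>j\<in>A. 1)" by simp
  also have "\<dots> = (\<Sum>j\<in>A. (\<Sum>r\<in>S. of_bool (int r dvd n j) * w r) ^ 2)"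
  proof (intro sum.cong refl)
    fix j assume j: "j \<in> A"
    have one: "r = 1" if "r \<in> S" "int r dvd n j" for r
    proof -
      have "prime (n j)" "n j > int R" "r \<le> R"
        using j that by (auto simp: A_def S_def selberg_set_def)
      then have "int r = 1 \<or> int r = n j"
        using that(2) unfolding prime_int_iff by (meson of_nat_0_le_iff)
      then show ?thesis using \<open>n j > int R\<close> \<open>r \<le> R\<close> by auto
    qed
    have "(\<Sum>r\<in>S. of_bool (int r dvd n j) * w r) = (\<Sum>r\<in>S. if r = 1 then w 1 else 0)"
    proof (intro sum.cong refl)
      fix r assume r: "r \<in> S"
      show "of_bool (int r dvd n j) * w r = (if r = 1 then w 1 else 0)"
      proof (cases "int r dvd n j")
        case True
        then show ?thesis using one[OF r True] by simp
      next
        case False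
        then have "r \<noteq> 1" by auto
        then show ?thesis using False by simp
      qed
    qed
    also have "\<dots> = w 1"
      using assms(1) fin by (simp add: S_def selberg_set_def)
    also have "\<dots> = 1"
      unfolding w_def by (rule selberg_weight_1[OF assms(1)])
    finally show "1 = (\<Sum>r\<in>S. of_bool (int r dvd n j) * w r) ^ 2" by simp
  qed
  also have "\<dots> \<le> (\<Sum>j\<in>{1..N}. (\<Sum>r\<in>S. of_bool (int r dvd n j) * w r) ^ 2)"
    by (intro sum_mono2) (auto simp: A_def)
  also have "\<dots> = (\<Sum>j\<in>{1..N}. \<Sum>r\<in>S. \<Sum>r'\<in>S. w r * w r' * of_bool (int (lcm r r') dvd n j))"
    unfolding power2_eq_square sum_product
    by (intro sum.cong refl) (simp flip: lcm_int_int_eq)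
  also have "\<dots> = (\<Sum>r\<in>S. \<Sum>j\<in>{1..N}. \<Sum>r'\<in>S. w r * w r' * of_bool (int (lcm r r') dvd n j))"
    by (rule sum.swap)
  also have "\<dots> = (\<Sum>r\<in>S. \<Sum>r'\<in>S. \<Sum>j\<in>{1..N}. w r * w r' * of_bool (int (lcm r r') dvd n j))"
    by (intro sum.cong refl sum.swap)
  also have "\<dots> = (\<Sum>r\<in>S. \<Sum>r'\<in>S. w r * w r' * real (card {j \<in> {1..N}. int (lcm r r') dvd n j}))"
  proof (intro sum.cong refl)
    fix r r'
    have "real (card {j \<in> {1..N}. int (lcm r r') dvd n j}) = (\<Sum>j\<in>{1..N}. of_bool (int (lcm r r') dvd n j))"
      by (simp add: Int_def)
    then show "(\<Sum>j\<in>{1..N}. w r * w r' * of_bool (int (lcm r r') dvd n j)) =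
               w r * w r' * real (card {j \<in> {1..N}. int (lcm r r') dvd n j})"
      by (simp only: sum_distrib_left)
  qed
  also have "\<dots> \<le> (\<Sum>r\<in>S. \<Sum>r'\<in>S. real N * (w r * w r' / real (lcm r r')) + \<bar>w r\<bar> * \<bar>w r'\<bar>)"
  proof (intro sum_mono)
    fix r r' assume r: "r \<in> S" "r' \<in> S"
    then have "lcm r r' > 0" "coprime (r * r') m"
      by (auto simp: S_def selberg_set_def lcm_pos_nat)
    moreover have "lcm r r' dvd r * r'" by (simp add: lcm_least)
    ultimately have "lcm r r' > 0" "coprime (lcm r r') m"
      using coprime_divisors[OF _ dvd_refl] by blast+
    then have "\<bar>real (card {j \<in> {1..N}. int (lcm r r') dvd n j}) - real N / real (lcm r r')\<bar> \<le> 1"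
      unfolding n_def by (intro card_dvd_linear)
    then have "\<bar>w r * w r'\<bar> * \<bar>real (card {j \<in> {1..N}. int (lcm r r') dvd n j}) - real N / real (lcm r r')\<bar> \<le> \<bar>w r * w r'\<bar> * 1"
      by (intro mult_left_mono) auto
    then have "w r * w r' * (real (card {j \<in> {1..N}. int (lcm r r') dvd n j}) - real N / real (lcm r r')) \<le> \<bar>w r\<bar> * \<bar>w r'\<bar>"
      by (simp add: abs_mult [symmetric])
    then show "w r * w r' * real (card {j \<in> {1..N}. int (lcm r r') dvd n j}) \<le>
        real N * (w r * w r' / real (lcm r r')) + \<bar>w r\<bar> * \<bar>w r'\<bar>"
      by (simp add: algebra_simps)
  qed
  also have "\<dots> = real N * (\<Sum>r\<in>S. \<Sum>r'\<in>S. w r * w r' / real (lcm r r')) + (\<Sum>r\<in>S. \<bar>w r\<bar>) ^ 2"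
    unfolding power2_eq_square sum_product sum.distrib by (simp only: sum_distrib_left)
  also have "(\<Sum>r\<in>S. \<Sum>r'\<in>S. w r * w r' / real (lcm r r')) = 1 / selberg_sum R m"
    unfolding S_def w_def by (rule selberg_quadratic_form[OF assms(1)])
  finally have "real (card A) \<le> real N / selberg_sum R m + (\<Sum>r\<in>S. \<bar>w r\<bar>) ^ 2" by simp
  moreover have "{j \<in> {1..N}. prime (n j)} = A \<union> C" by (auto simp: A_def C_def)
  then have "card {j \<in> {1..N}. prime (n j)} \<le> card A + card C"
    using card_Un_le[of A C] by simp
  then have "real (card {j \<in> {1..N}. prime (n j)}) \<le> real (card A) + real (card C)"
    by linarith
  ultimately show ?thesis using C by (simp add: n_def S_def w_def)
qed

text \<open>The sieve level \<open>M powr (2 / 5)\<close> gives any constant above \<open>5 / 2\<close>.\<close>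

lemma brun_titchmarsh:
  "\<exists>M0::real. \<forall>M\<ge>M0. \<forall>(m::nat) (a::int). m > 0 \<longrightarrow>
       real (card {j::nat. 1 \<le> j \<and> real j \<le> M \<and> prime (int m * int j + a)}) \<le>
       3 * M / ln M * (real m / real (totient m))"
proof -
  \<comment> \<open>The left side, of order \<open>M powr (4 / 5)\<close> up to logarithms, will
    bound the sieve remainder; \<open>1 / 2\<close> is the room between \<open>5 / 2\<close> and
    \<open>3\<close>.\<close>
  have "\<forall>\<^sub>F M::real in at_top. (M powr (2/5) * (ln M / ln 2 + 1))^2 + M powr (2/5) \<le> (1/2) * M / ln M"
    by real_asymp
  then obtain M1 where M1: "\<And>M::real. M \<ge> M1 \<Longrightarrow>
      (M powr (2/5) * (ln M / ln 2 + 1))^2 + M powr (2/5) \<le> (1/2) * M / ln M"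
    by (auto simp: eventually_at_top_linorder)
  show ?thesis
  proof (intro exI[of _ "max M1 2"] allI impI)
    fix M :: real and m :: nat and a :: int
    assume M: "M \<ge> max M1 2" and m: "m > 0"
    define R where "R = nat \<lfloor>M powr (2/5)\<rfloor>"
    define N where "N = nat \<lfloor>M\<rfloor>"
    define v where "v = ln M / ln 2 + 1"
    have lnM: "ln M > 0" using M by simp
    have p1: "M powr (2/5) \<ge> 1" using M by (intro ge_one_powr_ge_zero) auto
    then have R1: "R \<ge> 1" by (simp add: R_def le_nat_iff)
    have R: "real R \<le> M powr (2/5)" "M powr (2/5) < real R + 1"
      using p1 unfolding R_def by linarith+
    have "M powr (2/5) \<le> M powr 1" using M by (intro powr_mono) auto
    then have RM: "real R \<le> M" using R M by simp
    have N: "real N \<le> M" using M by (simp add: N_def)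
    have t: "totient m > 0" "real m > 0" using m by auto
    define G where "G = selberg_sum R m"
    have G0: "G > 0" using selberg_sum_pos[OF R1] by (simp add: G_def)
    \<comment> \<open>The \<open>R + 1\<close> in the lower bound for the Selberg sum absorbs the
      rounding of \<open>R\<close>.\<close>
    have "2/5 * ln M = ln (M powr (2/5))" using M by (simp add: ln_powr)
    also have "\<dots> \<le> ln (real R + 1)" using R p1 by (subst ln_le_cancel_iff) auto
    also have "\<dots> \<le> real m / real (totient m) * G"
      unfolding G_def by (rule selberg_sum_lower_bound[OF m])
    finally have Gl: "2/5 * ln M \<le> real m / real (totient m) * G" .
    have "real N / G \<le> M / G" using N G0 by (intro divide_right_mono) auto
    also have "\<dots> \<le> 5/2 * M / ln M * (real m / real (totient m))"
    proof -
      have "M * (2/5 * ln M) \<le> M * (real m / real (totient m) * G)"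
        using Gl M by (intro mult_left_mono) auto
      then show ?thesis using G0 lnM t by (simp add: field_simps)
    qed
    finally have main: "real N / G \<le> 5/2 * M / ln M * (real m / real (totient m))" .
    have v: "\<bar>selberg_weight R m r\<bar> \<le> v" if "r \<in> selberg_set R m" for r
    proof -
      have "\<bar>selberg_weight R m r\<bar> \<le> ln (real R) / ln 2 + 1"
        using that by (rule abs_selberg_weight_le)
      also have "\<dots> \<le> v"
        unfolding v_def using RM R1 M
        by (intro add_right_mono divide_right_mono) (auto simp: ln_le_cancel_iff)
      finally show ?thesis .
    qed
    have v0: "v \<ge> 0" using lnM by (simp add: v_def)
    have "card (selberg_set R m) \<le> card {1..R}"
      by (rule card_mono) (auto simp: selberg_set_def)
    then have cS: "real (card (selberg_set R m)) \<le> M powr (2/5)" using R by simp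
    have "(\<Sum>r\<in>selberg_set R m. \<bar>selberg_weight R m r\<bar>) \<le> (\<Sum>r\<in>selberg_set R m. v)"
      by (intro sum_mono v)
    also have "\<dots> = real (card (selberg_set R m)) * v" by simp
    also have "\<dots> \<le> M powr (2/5) * v" using cS v0 by (intro mult_right_mono)
    finally have "(\<Sum>r\<in>selberg_set R m. \<bar>selberg_weight R m r\<bar>) ^ 2 \<le> (M powr (2/5) * v) ^ 2"
      by (intro power_mono) (auto intro: sum_nonneg)
    then have "(\<Sum>r\<in>selberg_set R m. \<bar>selberg_weight R m r\<bar>) ^ 2 + real R \<le> (M powr (2/5) * v) ^ 2 + M powr (2/5)"
      using R by simp
    also have "\<dots> \<le> (1/2) * M / ln M" unfolding v_def using M by (intro M1) auto
    also have "\<dots> \<le> (1/2) * M / ln M * (real m / real (totient m))"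
    proof -
      have "1 \<le> real m / real (totient m)" using t totient_le[of m] by simp
      then have "(1/2) * M / ln M * 1 \<le> (1/2) * M / ln M * (real m / real (totient m))"
        using M lnM by (intro mult_left_mono) auto
      then show ?thesis by simp
    qed
    finally have err: "(\<Sum>r\<in>selberg_set R m. \<bar>selberg_weight R m r\<bar>) ^ 2 + real R \<le>
        (1/2) * M / ln M * (real m / real (totient m))" .
    have "{j::nat. 1 \<le> j \<and> real j \<le> M \<and> prime (int m * int j + a)} =
          {j \<in> {1..N}. prime (int m * int j + a)}"
      using M by (auto simp: N_def le_nat_iff le_floor_iff)
    then have "real (card {j::nat. 1 \<le> j \<and> real j \<le> M \<and> prime (int m * int j + a)}) \<le>
       real N / G + (\<Sum>r\<in>selberg_set R m. \<bar>selberg_weight R m r\<bar>) ^ 2 + real R"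
      using selberg_sieve[OF R1 m, of N a] by (simp only: G_def)
    also have "\<dots> \<le> 5/2 * M / ln M * (real m / real (totient m)) + (1/2) * M / ln M * (real m / real (totient m))"
      using main err by simp
    also have "\<dots> = 3 * M / ln M * (real m / real (totient m))"
      by (simp add: field_simps)
    finally show "real (card {j::nat. 1 \<le> j \<and> real j \<le> M \<and> prime (int m * int j + a)}) \<le>
       3 * M / ln M * (real m / real (totient m))" .
  qed
qed

subsection \<open>Shifted primes in arithmetic progressions\<close>

text \<open>\<open>totient (d * q)\<close> is \<open>q * totient d\<close> if \<open>q\<close>
  divides \<open>d\<close> and \<open>(q - 1) * totient d\<close> otherwise. Both cases occur for
  the moduli \<open>d * q\<close> of the bad \<open>k\<close>.\<close>

lemma self_div_totient_mult_prime:
  assumes "prime q" and "d > 0"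
  shows "real (d * q) / real (totient (d * q)) \<le> real d / real (totient d) * (real q / (real q - 1))"
proof -
  have q: "q \<ge> 2" using assms(1) by (rule prime_ge_2_nat)
  have "totient d * (q - 1) \<le> totient (d * q)"
  proof (cases "q dvd d")
    case True
    then have "gcd d q = q" by (simp add: gcd_nat.absorb2)
    then have "totient (d * q) * totient q = totient d * q * totient q"
      using totient_gcd[of d q] by (simp add: mult_ac)
    moreover have "totient q > 0" using q by simp
    ultimately have "totient (d * q) = totient d * q" by simp
    then show ?thesis by simp
  next
    case False
    then have "coprime d q" using prime_imp_coprime[OF assms(1)] by (simp add: coprime_commute)
    then show ?thesis using assms(1) by (simp add: totient_mult_coprime totient_prime)
  qed
  then have le: "real (totient d) * (real q - 1) \<le> real (totient (d * q))"
    using q by (metis (no_types, lifting) of_nat_1 of_nat_diff of_nat_le_iff of_nat_mult one_le_numeral order_trans)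
  have pos: "real (totient d) * (real q - 1) > 0" using q assms(2) by simp
  have "real (d * q) / real (totient (d * q)) \<le> real (d * q) / (real (totient d) * (real q - 1))"
    using le pos by (intro frac_le) auto
  then show ?thesis by simp
qed

text \<open>A prime \<open>p\<close> in the progression with
  \<open>\<bar>a\<bar> < p <= d * X\<close> has the form \<open>d * k + a\<close> with
  \<open>k\<close> in the stated range; the smaller primes cost the final
  \<open>\<bar>a\<bar>\<close>. Requiring values above \<open>\<bar>a\<bar>\<close> will make
  \<open>k\<close> coprime to \<open>a\<close>.\<close>

lemma count_primes_shifted:
  fixes d :: nat and a :: int and X x :: real
  assumes "d > 0" and "X \<ge> 200" and "real d * X \<le> x"
    and pi: "real (prime_pi_ap (real d * X) d a) \<ge> real (prime_pi (real d * X)) / (2 * real (totient d))"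
  shows "real (card {k::nat. 1 \<le> k \<and> real k \<le> X + real_of_int \<bar>a\<bar> \<and> real_of_int (int d * int k + a) \<le> x \<and>
            int d * int k + a > \<bar>a\<bar> \<and> prime (int d * int k + a)}) \<ge>
         33 / 100 * (real d / real (totient d)) * X / ln x - real_of_int \<bar>a\<bar>"
proof -
  define y where "y = real d * X"
  define K where "K = {k::nat. 1 \<le> k \<and> real k \<le> X + real_of_int \<bar>a\<bar> \<and> real_of_int (int d * int k + a) \<le> x \<and>
            int d * int k + a > \<bar>a\<bar> \<and> prime (int d * int k + a)}"
  define P where "P = {p::nat. prime p \<and> real p \<le> y \<and> [int p = a] (mod (int d))}"
  have "1 * X \<le> real d * X" using assms by (intro mult_right_mono) auto
  then have y: "y \<ge> 200" "y \<le> x" using assms(2,3) unfolding y_def by linarith+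
  have finK: "finite K"
  proof (rule finite_subset)
    show "K \<subseteq> {..nat \<lfloor>X + real_of_int \<bar>a\<bar>\<rfloor>}"
      unfolding K_def atMost_def by (intro Collect_mono impI) (blast intro: le_nat_floor)
  qed simp
  have "P \<subseteq> {1..nat \<bar>a\<bar>} \<union> (\<lambda>k. nat (int d * int k + a)) ` K"
  proof
    fix p assume p: "p \<in> P"
    then have p1: "prime p" "p > 0" "real p \<le> y" by (auto simp: P_def prime_gt_0_nat)
    show "p \<in> {1..nat \<bar>a\<bar>} \<union> (\<lambda>k. nat (int d * int k + a)) ` K"
    proof (cases "p \<le> nat \<bar>a\<bar>")
      case True
      then show ?thesis using p1 by auto
    next
      case False
      have "int d dvd int p - a" using p by (simp add: P_def cong_iff_dvd_diff)
      then obtain t where t: "int p - a = int d * t" by blast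
      have "int d * t > 0" using t False by linarith
      then have "t > 0" using assms(1) by (simp add: zero_less_mult_iff)
      define k where "k = nat t"
      have k: "int k = t" "k \<ge> 1" using \<open>t > 0\<close> by (auto simp: k_def)
      have pk: "int d * int k + a = int p" using t k by simp
      have "real d * real k = real p - real_of_int a"
        using pk by (metis add_diff_cancel_right' of_int_add of_int_mult of_int_of_nat_eq)
      also have "\<dots> \<le> real d * X + real_of_int \<bar>a\<bar>" using p1 by (simp add: y_def)
      also have "\<dots> \<le> real d * X + real d * real_of_int \<bar>a\<bar>"
        using assms(1) mult_right_mono[of 1 "real d" "real_of_int \<bar>a\<bar>"] by simp
      finally have "real d * real k \<le> real d * (X + real_of_int \<bar>a\<bar>)" by (simp add: algebra_simps)
      then have "real k \<le> X + real_of_int \<bar>a\<bar>"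
        using assms(1) by (simp only: mult_le_cancel_left_pos of_nat_0_less_iff)
      moreover have "int p > \<bar>a\<bar>" using False by linarith
      ultimately have "k \<in> K"
        using k p1 y unfolding K_def mem_Collect_eq pk by simp
      moreover have "p = nat (int d * int k + a)" by (simp only: pk nat_int)
      ultimately show ?thesis by blast
    qed
  qed
  then have "card P \<le> card ({1..nat \<bar>a\<bar>} \<union> (\<lambda>k. nat (int d * int k + a)) ` K)"
    using finK by (intro card_mono) auto
  also have "\<dots> \<le> nat \<bar>a\<bar> + card K"
    using card_Un_le[of "{1..nat \<bar>a\<bar>}"] card_image_le[OF finK] by (metis (no_types, lifting) add_left_mono card_atLeastAtMost diff_Suc_1 le_trans One_nat_def)
  finally have "card P \<le> nat \<bar>a\<bar> + card K" .
  then have cP: "real (card K) \<ge> real (card P) - real_of_int \<bar>a\<bar>" by linarith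
  have ln: "ln y > 0" "ln x > 0" using y by auto
  \<comment> \<open>Equality holds at \<open>y = 200\<close>, whence the hypothesis
    \<open>X >= 200\<close>. The \<open>2\<close> in the denominator of \<open>pi\<close> turns
    \<open>66 / 100\<close> into \<open>33 / 100\<close>.\<close>
  have "66 / 100 * y \<le> 2 / 3 * (y - 2)" using y by simp
  also have "\<dots> \<le> real (prime_pi y) * ln y" using y by (intro prime_pi_lower_bound) auto
  also have "\<dots> \<le> real (prime_pi y) * ln x" using y by (intro mult_left_mono) auto
  finally have "66 / 100 * y / ln x \<le> real (prime_pi y)" using ln by (simp add: divide_le_eq)
  then have "66 / 100 * y / ln x / (2 * real (totient d)) \<le> real (prime_pi y) / (2 * real (totient d))"
    by (intro divide_right_mono) auto
  also have "\<dots> \<le> real (card P)"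
    using pi unfolding y_def[symmetric] prime_pi_ap_def P_def .
  finally have "33 / 100 * (real d / real (totient d)) * X / ln x \<le> real (card P)"
    by (simp add: y_def field_simps)
  with cP show ?thesis by (simp add: K_def)
qed

text \<open>One term is at most the whole sum, which is below \<open>1 / 32\<close>.\<close>

lemma prime_gt_32_of_sum_inverse_le:
  fixes c :: real
  assumes "(\<Sum>q\<in>prime_factors L. 1 / real q) \<le> c / 32" and "c < 1" and "q \<in> prime_factors L"
  shows "q \<ge> 33"
proof -
  have "1 / real q \<le> (\<Sum>q\<in>prime_factors L. 1 / real q)"
    using assms(3) by (intro member_le_sum) auto
  then have "1 / real q < 1 / 32" using assms by simp
  moreover have "q > 0" using assms(3) by (auto intro: prime_gt_0_nat)
  ultimately show ?thesis by (simp add: field_simps)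
qed

text \<open>Writing \<open>k = q * j\<close> gives primes \<open>d * q * j + a\<close> with
  \<open>j <= (X + A) / q\<close>. As \<open>q <= x powr (c / 2)\<close>, this range has length at
  least \<open>x powr (c / 2)\<close>, so Brun--Titchmarsh applies and its logarithm is at least
  \<open>c / 2 * ln x\<close>. The resulting factor \<open>1 / c\<close> is compensated by the
  \<open>c\<close> in the bound for the sum of \<open>1 / q\<close>.\<close>

lemma count_bad_multiples:
  fixes d L :: nat and a :: int and X x M0 c :: real
  assumes BT: "\<forall>M\<ge>M0. \<forall>(m::nat) (a::int). m > 0 \<longrightarrow>
       real (card {j::nat. 1 \<le> j \<and> real j \<le> M \<and> prime (int m * int j + a)}) \<le>
       3 * M / ln M * (real m / real (totient m))"
    and M0: "x powr (c / 2) \<ge> M0"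
    and X: "X = x powr c" and x: "x > 1" and c: "0 < c" "c < 1"
    and L: "\<forall>p. prime p \<longrightarrow> real p > x powr (c / 2) \<longrightarrow> \<not> p dvd L" "L > 0"
    and sum: "(\<Sum>q\<in>prime_factors L. 1 / real q) \<le> c / 32"
    and d: "d > 0" and A: "A \<ge> 0"
  shows "real (card {k::nat. 1 \<le> k \<and> real k \<le> X + A \<and> (\<exists>q\<in>prime_factors L. q dvd k) \<and>
           prime (int d * int k + a)}) \<le>
         99 / 512 * (real d / real (totient d)) * (X + A) / ln x"
proof -
  define Q where "Q q = {j::nat. 1 \<le> j \<and> real j \<le> (X + A) / real q \<and> prime (int (d * q) * int j + a)}" for q
  define K where "K = {k::nat. 1 \<le> k \<and> real k \<le> X + A \<and> (\<exists>q\<in>prime_factors L. q dvd k) \<and>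
           prime (int d * int k + a)}"
  have lnx: "ln x > 0" using x by simp
  have X0: "X > 0" using x X by simp
  have finQ: "finite (Q q)" for q
  proof (rule finite_subset)
    show "Q q \<subseteq> {..nat \<lfloor>(X + A) / real q\<rfloor>}" by (auto simp: Q_def le_nat_floor)
  qed simp
  have Q: "real (card (Q q)) \<le> (99 / 16 * (real d / real (totient d)) * (X + A) / (c * ln x)) * (1 / real q)"
    if q: "q \<in> prime_factors L" for q
  proof -
    have pq: "prime q" "q dvd L" using q by auto
    have q33: "q \<ge> 33" using prime_gt_32_of_sum_inverse_le[OF sum c(2) q] .
    have "real q \<le> x powr (c / 2)" using L(1) pq not_le by blast
    then have "x powr c / x powr (c / 2) \<le> X / real q"
      unfolding X using q33 x by (intro divide_left_mono) auto
    moreover have "x powr c / x powr (c / 2) = x powr (c / 2)"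
      by (simp flip: powr_diff)
    moreover have "X / real q \<le> (X + A) / real q" using A by (intro divide_right_mono) auto
    ultimately have M: "x powr (c / 2) \<le> (X + A) / real q" by simp
    have "c / 2 * ln x = ln (x powr (c / 2))" using x by (simp add: ln_powr)
    also have "\<dots> \<le> ln ((X + A) / real q)"
      using M x X0 A q33 by (subst ln_le_cancel_iff) auto
    finally have lnM: "c / 2 * ln x \<le> ln ((X + A) / real q)" .
    have "real (d * q) / real (totient (d * q)) \<le> real d / real (totient d) * (real q / (real q - 1))"
      by (rule self_div_totient_mult_prime[OF pq(1) d])
    also have "\<dots> \<le> real d / real (totient d) * (33 / 32)"
      using q33 by (intro mult_left_mono) (auto simp: field_simps)
    finally have tot: "real (d * q) / real (totient (d * q)) \<le> real d / real (totient d) * (33 / 32)" .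
    have "real (card (Q q)) \<le> 3 * ((X + A) / real q) / ln ((X + A) / real q) * (real (d * q) / real (totient (d * q)))"
      unfolding Q_def using M M0 q33 d by (intro BT[rule_format]) auto
    also have "\<dots> \<le> 3 * ((X + A) / real q) / (c / 2 * ln x) * (real d / real (totient d) * (33 / 32))"
    proof (rule mult_mono)
      have "c / 2 * ln x > 0" using c lnx by simp
      then show "3 * ((X + A) / real q) / ln ((X + A) / real q) \<le> 3 * ((X + A) / real q) / (c / 2 * ln x)"
        using lnM X0 A by (intro frac_le) auto
    qed (use tot lnx c X0 A in auto)
    \<comment> \<open>Here \<open>99 / 16 = 3 * 2 * (33 / 32)\<close>, with \<open>2\<close> from
      \<open>c / 2\<close>; the later factor \<open>c / 32\<close> makes it
      \<open>99 / 512\<close>.\<close>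
    also have "\<dots> = (99 / 16 * (real d / real (totient d)) * (X + A) / (c * ln x)) * (1 / real q)"
      using q33 lnx c d by (simp add: field_simps)
    finally show ?thesis .
  qed
  have "K \<subseteq> (\<Union>q\<in>prime_factors L. (\<lambda>j. q * j) ` Q q)"
  proof
    fix k assume k: "k \<in> K"
    then obtain q where q: "q \<in> prime_factors L" "q dvd k" by (auto simp: K_def)
    then obtain j where j: "k = q * j" by blast
    have q0: "q > 0" using q by (auto intro: prime_gt_0_nat)
    have "j \<in> Q q"
      using k q0 unfolding K_def Q_def j
      by (auto simp: field_simps Suc_le_eq)
    then show "k \<in> (\<Union>q\<in>prime_factors L. (\<lambda>j. q * j) ` Q q)" using q j by blast
  qed
  then have "card K \<le> card (\<Union>q\<in>prime_factors L. (\<lambda>j. q * j) ` Q q)"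
    using finQ by (intro card_mono) auto
  also have "\<dots> \<le> (\<Sum>q\<in>prime_factors L. card ((\<lambda>j. q * j) ` Q q))"
    by (rule card_UN_le) simp
  also have "\<dots> \<le> (\<Sum>q\<in>prime_factors L. card (Q q))"
    by (intro sum_mono card_image_le finQ)
  finally have "real (card K) \<le> (\<Sum>q\<in>prime_factors L. real (card (Q q)))"
    by (metis of_nat_le_iff of_nat_sum)
  also have "\<dots> \<le> (\<Sum>q\<in>prime_factors L. (99 / 16 * (real d / real (totient d)) * (X + A) / (c * ln x)) * (1 / real q))"
    by (intro sum_mono Q)
  also have "\<dots> = (99 / 16 * (real d / real (totient d)) * (X + A) / (c * ln x)) * (\<Sum>q\<in>prime_factors L. 1 / real q)"
    by (simp only: sum_distrib_left)
  also have "\<dots> \<le> (99 / 16 * (real d / real (totient d)) * (X + A) / (c * ln x)) * (c / 32)"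
    using sum lnx c X0 A by (intro mult_left_mono) auto
  also have "\<dots> = 99 / 512 * (real d / real (totient d)) * (X + A) / ln x"
    using c lnx d by (simp add: field_simps)
  finally show ?thesis by (simp add: K_def)
qed

text \<open>Suppose \<open>k\<close> from \<open>count_primes_shifted\<close> shares a prime
  \<open>r\<close> with \<open>a * L\<close>. If \<open>r\<close> divided \<open>a\<close>, it would
  divide the prime \<open>d * k + a\<close> and so equal it, but that prime exceeds
  \<open>\<bar>a\<bar>\<close>. So \<open>r\<close> divides \<open>L\<close> and \<open>k\<close> is
  bad; the bound is the difference of the two counts.\<close>

lemma count_good:
  fixes d L :: nat and a :: int and X x M0 c :: real
  assumes BT: "\<forall>M\<ge>M0. \<forall>(m::nat) (a::int). m > 0 \<longrightarrow>
       real (card {j::nat. 1 \<le> j \<and> real j \<le> M \<and> prime (int m * int j + a)}) \<le>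
       3 * M / ln M * (real m / real (totient m))"
    and M0: "x powr (c / 2) \<ge> M0"
    and X: "X = x powr c" and x: "x > 1" and c: "0 < c" "c < 1"
    and L: "\<forall>p. prime p \<longrightarrow> real p > x powr (c / 2) \<longrightarrow> \<not> p dvd L" "L > 0"
    and sum: "(\<Sum>q\<in>prime_factors L. 1 / real q) \<le> c / 32"
    and d: "d > 0" and a: "a \<noteq> 0"
    and X200: "X \<ge> 200" and dX: "real d * X \<le> x"
    and pi: "real (prime_pi_ap (real d * X) d a) \<ge> real (prime_pi (real d * X)) / (2 * real (totient d))"
    and large: "33 / 100 * X - 99 / 512 * (X + real_of_int \<bar>a\<bar>) - real_of_int \<bar>a\<bar> * ln x \<ge>
                1 / 8 * (X + real_of_int \<bar>a\<bar>)"
  shows "real (card {k::nat. 1 \<le> k \<and> real k \<le> X + real_of_int \<bar>a\<bar> \<and> gcd (int k) (a * int L) = 1 \<and>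
           real_of_int (int d * int k + a) \<le> x \<and> prime (int d * int k + a)}) \<ge>
         1 / 8 * (X + real_of_int \<bar>a\<bar>) / ln x"
proof -
  define A where "A = real_of_int \<bar>a\<bar>"
  define K where "K = {k::nat. 1 \<le> k \<and> real k \<le> X + A \<and> real_of_int (int d * int k + a) \<le> x \<and>
            int d * int k + a > \<bar>a\<bar> \<and> prime (int d * int k + a)}"
  define Bad where "Bad = {k::nat. 1 \<le> k \<and> real k \<le> X + A \<and> (\<exists>q\<in>prime_factors L. q dvd k) \<and>
           prime (int d * int k + a)}"
  define Good where "Good = {k::nat. 1 \<le> k \<and> real k \<le> X + A \<and> gcd (int k) (a * int L) = 1 \<and>
           real_of_int (int d * int k + a) \<le> x \<and> prime (int d * int k + a)}"
  have lnx: "ln x > 0" using x by simp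
  have fin: "finite Good" "finite Bad"
    by (rule finite_subset[of _ "{..nat \<lfloor>X + A\<rfloor>}"]; auto simp: Good_def Bad_def le_nat_floor)+
  have "K \<subseteq> Good \<union> Bad"
  proof
    fix k assume k: "k \<in> K"
    show "k \<in> Good \<union> Bad"
    proof (cases "gcd (int k) (a * int L) = 1")
      case True
      then show ?thesis using k by (auto simp: K_def Good_def)
    next
      case False
      then have "\<not> is_unit (gcd (int k) (a * int L))"
        unfolding is_unit_gcd_iff .
      moreover have "gcd (int k) (a * int L) \<noteq> 0" using k by (auto simp: K_def)
      ultimately obtain r where r: "prime r" "r dvd gcd (int k) (a * int L)"
        using prime_divisor_exists by blast
      define p where "p = int d * int k + a"
      have p: "prime p" "p > \<bar>a\<bar>" using k by (auto simp: K_def p_def)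
      have rk: "r dvd int k" using r by auto
      have "\<not> r dvd a"
      proof
        assume ra: "r dvd a"
        then have "r dvd p" using rk by (simp add: p_def)
        then have "r = p" using r(1) p(1) by (simp add: primes_dvd_imp_eq)
        then have "p \<le> \<bar>a\<bar>" using ra a dvd_imp_le_int by (metis abs_ge_self order_trans)
        with p show False by simp
      qed
      then have "r dvd int L" using r by (auto dest: prime_dvd_multD)
      have r': "r = int (nat r)" "prime (nat r)" using r(1) by (auto simp: prime_ge_0_int)
      then have "nat r dvd L" "nat r dvd k"
        using \<open>r dvd int L\<close> rk by (metis int_dvd_int_iff)+
      then have "nat r \<in> prime_factors L" "nat r dvd k" using r' L(2) by (auto simp: prime_factors_dvd)
      then show ?thesis using k by (auto simp: K_def Bad_def)
    qed
  qed
  then have "card K \<le> card (Good \<union> Bad)" using fin by (intro card_mono) auto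
  also have "\<dots> \<le> card Good + card Bad" by (rule card_Un_le)
  finally have "real (card Good) \<ge> real (card K) - real (card Bad)" by linarith
  moreover have "real (card K) \<ge> 33 / 100 * (real d / real (totient d)) * X / ln x - A"
    unfolding K_def A_def using d X200 dX pi by (rule count_primes_shifted)
  moreover have "real (card Bad) \<le> 99 / 512 * (real d / real (totient d)) * (X + A) / ln x"
    unfolding Bad_def using BT M0 X x c L sum d by (rule count_bad_multiples) (simp_all add: A_def)
  moreover have "33 / 100 * (real d / real (totient d)) * X / ln x - A -
      99 / 512 * (real d / real (totient d)) * (X + A) / ln x \<ge> 1 / 8 * (X + A) / ln x"
  proof -
    have A0: "A \<ge> 0" by (simp add: A_def)
    define u where "u = 33 / 100 * X - 99 / 512 * (X + A)"
    have u: "u - A * ln x \<ge> 1 / 8 * (X + A)" using large by (simp add: u_def A_def)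
    moreover have "A * ln x \<ge> 0" using A0 lnx by simp
    ultimately have u0: "u \<ge> 0" using A0 X200 by simp
    \<comment> \<open>Both counts carry the factor \<open>d / totient d\<close>. As
      \<open>u >= 0\<close>, it may be replaced by \<open>1\<close>, which makes the bound uniform
      in \<open>d\<close>.\<close>
    have "1 \<le> real d / real (totient d)" using d totient_le[of d] by simp
    then have "1 * u \<le> real d / real (totient d) * u" using u0 by (intro mult_right_mono)
    then have "1 / 8 * (X + A) + A * ln x \<le> real d / real (totient d) * u" using u by linarith
    then have "(1 / 8 * (X + A) + A * ln x) / ln x \<le> real d / real (totient d) * u / ln x"
      using lnx by (intro divide_right_mono) auto
    moreover have "(1 / 8 * (X + A) + A * ln x) / ln x = 1 / 8 * (X + A) / ln x + A"
      using lnx by (simp add: add_divide_distrib)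
    moreover have "real d / real (totient d) * u / ln x =
       33 / 100 * (real d / real (totient d)) * X / ln x - 99 / 512 * (real d / real (totient d)) * (X + A) / ln x"
      unfolding u_def by (simp add: algebra_simps add_divide_distrib diff_divide_distrib)
    ultimately show ?thesis by linarith
  qed
  ultimately show ?thesis unfolding Good_def A_def by linarith
qed

section \<open>Divisors avoiding given primes, and the pigeonhole argument\<close>

text \<open>Each prime \<open>p\<close> costs at most a factor \<open>2\<close>: division by
  \<open>p\<close> maps the divisors divisible by \<open>p\<close> injectively to divisors prime to
  \<open>p\<close>, because \<open>L\<close> is squarefree, and quotients stay below
  \<open>Z\<close>.\<close>

lemma card_divisors_le_two_power:
  fixes L :: nat and Z :: real
  assumes "squarefree L" and "L > 0" and "finite T" and "\<And>p. p \<in> T \<Longrightarrow> prime p"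
  shows "card {d. d dvd L \<and> real d \<le> Z} \<le>
         2 ^ card T * card {d. d dvd L \<and> real d \<le> Z \<and> (\<forall>p\<in>T. \<not> p dvd d)}"
  using assms(3,4)
proof (induction T rule: finite_induct)
  case empty
  then show ?case by simp
next
  case (insert p T)
  define A where "A T = {d. d dvd L \<and> real d \<le> Z \<and> (\<forall>p\<in>T. \<not> p dvd d)}" for T
  have fin: "finite (A T)" for T
    using \<open>L > 0\<close> unfolding A_def by (auto intro: finite_subset[OF _ finite_divisors_nat])
  have p: "prime p" using insert by auto
  define U where "U = {d \<in> A T. p dvd d}"
  have "card U \<le> card (A (insert p T))"
  proof (rule card_inj_on_le)
    show "inj_on (\<lambda>d. d div p) U"
      by (rule inj_onI) (auto simp: U_def dvd_div_eq_iff)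
    show "(\<lambda>d. d div p) ` U \<subseteq> A (insert p T)"
    proof safe
      fix d assume "d \<in> U"
      then have d: "d dvd L" "real d \<le> Z" "\<forall>q\<in>T. \<not> q dvd d" "p dvd d"
        by (auto simp: U_def A_def)
      then obtain c where c: "d = p * c" by blast
      have "\<not> p dvd c"
      proof
        assume "p dvd c"
        then have "p ^ 2 dvd L"
          using c d(1) by (metis dvd_trans mult_dvd_mono dvd_refl power2_eq_square)
        with assms(1) p show False by (auto dest: squarefreeD)
      qed
      moreover have "c dvd d" using c by simp
      moreover have "real c \<le> real d"
        using c prime_gt_0_nat[OF p] by (simp flip: of_nat_mult)
      ultimately have "c \<in> A (insert p T)"
        using d by (auto simp: A_def intro: dvd_trans)
      then show "d div p \<in> A (insert p T)"
        using c p by simp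
    qed
  qed (rule fin)
  moreover have "A T = U \<union> A (insert p T)"
    by (auto simp: U_def A_def)
  ultimately have "card (A T) \<le> 2 * card (A (insert p T))"
    using card_Un_le[of U "A (insert p T)"] by simp
  moreover have "card {d. d dvd L \<and> real d \<le> Z} \<le> 2 ^ card T * card (A T)"
    using insert unfolding A_def by auto
  ultimately have "card {d. d dvd L \<and> real d \<le> Z} \<le> 2 ^ card T * (2 * card (A (insert p T)))"
    by (meson le_trans mult_le_mono2)
  then show ?case
    using insert(1,2) unfolding A_def by (simp add: mult_ac)
qed

text \<open>One prime factor of each \<open>m\<close> in \<open>E\<close> suffices, since a number
  it does not divide is not a multiple of \<open>m\<close>. This turns the conditions on
  \<open>d\<close> into the form required by \<open>card_divisors_le_two_power\<close>.\<close>

lemma exceptional_primes: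
  fixes E :: "int set" and a :: int
  assumes "finite E" and m1: "\<forall>m\<in>E. m > 1" and "a \<noteq> 0"
  shows "\<exists>T::nat set. finite T \<and> (\<forall>p\<in>T. prime p) \<and> card T \<le> card E + omega a \<and>
    (\<forall>d>0. (\<forall>p\<in>T. \<not> p dvd d) \<longrightarrow> coprime a (int d) \<and> (\<forall>m\<in>E. \<not> m dvd int d))"
proof -
  have "\<exists>p. prime p \<and> int p dvd m" if "m \<in> E" for m
  proof -
    have "nat m \<noteq> 1" using bspec[OF m1 that] by auto
    then obtain p where "prime p" "p dvd nat m" using prime_factor_nat by blast
    then have "int p dvd int (nat m)" by (simp only: int_dvd_int_iff)
    then have "int p dvd m" using bspec[OF m1 that] by simp
    with \<open>prime p\<close> show ?thesis by blast
  qed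
  then obtain f where f: "\<And>m. m \<in> E \<Longrightarrow> prime (f m) \<and> int (f m) dvd m" by metis
  define T where "T = f ` E \<union> prime_factors (nat \<bar>a\<bar>)"
  show ?thesis
  proof (intro exI[of _ T] conjI ballI allI impI)
    show "finite T" using assms(1) by (simp add: T_def)
    show "prime p" if "p \<in> T" for p using that f by (auto simp: T_def)
    show "card T \<le> card E + omega a"
      unfolding T_def omega_def
      by (rule order_trans[OF card_Un_le add_right_mono[OF card_image_le[OF assms(1)]]])
  next
    fix d :: nat assume d: "d > 0" "\<forall>p\<in>T. \<not> p dvd d"
    show "coprime a (int d)"
    proof (rule ccontr)
      assume "\<not> coprime a (int d)"
      then have "\<not> coprime (nat \<bar>a\<bar>) d" by (simp add: coprime_int_iff [symmetric])
      then obtain p where "prime p" "p dvd nat \<bar>a\<bar>" "p dvd d"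
        by (metis coprime_iff_gcd_eq_1 gcd_nat.boundedE prime_factor_nat)
      then have "p \<in> T" using assms(3) by (auto simp: T_def prime_factors_dvd)
      with d \<open>p dvd d\<close> show False by blast
    qed
    show "\<not> m dvd int d" if "m \<in> E" for m
    proof
      assume "m dvd int d"
      then have "int (f m) dvd int d" using f[OF that] by (blast intro: dvd_trans)
      moreover have "f m \<in> T" using that by (simp add: T_def)
      ultimately show False using d by simp
    qed
  qed
qed

text \<open>The first claim rests on \<open>33 / 100 - 99 / 512 > 1 / 8\<close>, so a positive
  multiple of \<open>x powr c\<close> remains to dominate \<open>ln x\<close>.\<close>

lemma eventually_large:
  fixes c A M0 :: real
  assumes "c > 0" and "A > 0"
  shows "\<forall>\<^sub>F x in at_top. 33 / 100 * x powr c - 99 / 512 * (x powr c + A) - A * ln x \<ge> 1 / 8 * (x powr c + A)"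
    and "\<forall>\<^sub>F x in at_top. x powr c \<ge> 200"
    and "\<forall>\<^sub>F x in at_top. x powr (c / 2) \<ge> M0"
proof -
  show "\<forall>\<^sub>F x in at_top. 33 / 100 * x powr c - 99 / 512 * (x powr c + A) - A * ln x \<ge> 1 / 8 * (x powr c + A)"
    using assms by real_asymp
  show "\<forall>\<^sub>F x in at_top. x powr c \<ge> 200"
    using assms(1) by real_asymp
  have "filterlim (\<lambda>x. x powr (c / 2)) at_top at_top"
    using assms(1) by real_asymp
  then show "\<forall>\<^sub>F x in at_top. x powr (c / 2) \<ge> M0"
    by (simp add: filterlim_at_top)
qed

text \<open>Double counting of the pairs satisfying \<open>P\<close>: if every \<open>j\<close> fell
  short, their number would be below \<open>u * card I * card J\<close>.\<close>

lemma ex_large_fibre: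
  fixes P :: "'a \<Rightarrow> 'b \<Rightarrow> bool" and u v :: real
  assumes "finite I" and "finite J" and "J \<noteq> {}"
    and "\<And>i. i \<in> I \<Longrightarrow> u * real (card J) \<le> real (card {j \<in> J. P i j})"
  shows "\<exists>j\<in>J. u * real (card I) \<le> real (card {i \<in> I. P i j})"
proof (rule ccontr)
  assume "\<not> ?thesis"
  then have "(\<Sum>j\<in>J. real (card {i \<in> I. P i j})) < (\<Sum>j\<in>J. u * real (card I))"
    using assms(2,3) by (intro sum_strict_mono) auto
  also have "\<dots> = (\<Sum>i\<in>I. u * real (card J))" by (simp add: mult_ac)
  also have "\<dots> \<le> (\<Sum>i\<in>I. real (card {j \<in> J. P i j}))" by (intro sum_mono assms(4))
  also have "\<dots> = (\<Sum>i\<in>I. \<Sum>j\<in>{j \<in> J. P i j}. 1)" by simp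
  also have "\<dots> = (\<Sum>j\<in>J. \<Sum>i\<in>{i \<in> I. P i j}. 1)"
    using assms(1,2) by (rule sum.swap_restrict)
  also have "\<dots> = (\<Sum>j\<in>J. real (card {i \<in> I. P i j}))" by simp
  finally show False by simp
qed

theorem theorem3p1:
  fixes B :: real and D :: nat and a :: int
  assumes "B \<in> calB"
    and "associated B D"
    and "a \<noteq> 0"
  shows "\<exists>x3::real. \<forall>x\<ge>x3. \<forall>L::nat.
     L > 0 \<longrightarrow>
     squarefree L \<longrightarrow>
     (\<forall>p. prime p \<longrightarrow> real p > x powr ((1 - B) / 2) \<longrightarrow> \<not> p dvd L) \<longrightarrow>
     (\<Sum>q\<in>prime_factors L. 1 / real q) \<le> (1 - B) / 32 \<longrightarrow>
     (\<exists>k::nat. k > 0 \<and>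
        real k \<le> x powr (1 - B) + real_of_int \<bar>a\<bar> \<and>
        gcd (int k) (a * int L) = 1 \<and>
        real (card {d::nat. d dvd L \<and> real_of_int (int d * int k + a) \<le> x \<and>
                            prime (int d * int k + a)})
          \<ge> 2 powr (- real D - real (omega a) - 3) / ln x *
            real (card {d::nat. d dvd L \<and> 1 \<le> d \<and> real d \<le> x powr B}))"
proof -
  define c where "c = 1 - B"
  define A where "A = real_of_int \<bar>a\<bar>"
  have B: "0 < B" "B < 1" using assms(1) by (auto simp: calB_def)
  then have c: "0 < c" "c < 1" by (auto simp: c_def)
  have A: "A > 0" using assms(3) by (simp add: A_def)
  obtain M0 where BT: "\<forall>M\<ge>M0. \<forall>(m::nat) (a::int). m > 0 \<longrightarrow>
       real (card {j::nat. 1 \<le> j \<and> real j \<le> M \<and> prime (int m * int j + a)}) \<le>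
       3 * M / ln M * (real m / real (totient m))"
    using brun_titchmarsh by (elim exE) (rule that)
  obtain x2 where x2: "\<forall>x\<ge>x2. \<exists>E::int set.
        finite E \<and> card E \<le> D \<and> (\<forall>m\<in>E. real_of_int m > ln x) \<and>
        (\<forall>(y::real) (a::int) (d::nat).
           coprime a (int d) \<longrightarrow> 1 \<le> d \<longrightarrow>
           real d \<le> min (x powr B) (y / x powr (1 - B)) \<longrightarrow>
           (\<forall>m\<in>E. \<not> m dvd int d) \<longrightarrow>
           real (prime_pi_ap y d a) \<ge> real (prime_pi y) / (2 * real (totient d)))"
    using assms(2) unfolding associated_def by (elim conjE exE) (rule that)
  \<comment> \<open>The condition \<open>x >= exp 1\<close> gives \<open>ln x >= 1\<close>, so the
    exceptional moduli exceed \<open>1\<close> and have prime factors.\<close>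
  have "\<forall>\<^sub>F x in at_top. 33 / 100 * x powr c - 99 / 512 * (x powr c + A) - A * ln x \<ge> 1 / 8 * (x powr c + A)
      \<and> x powr c \<ge> 200 \<and> x powr (c / 2) \<ge> M0 \<and> x \<ge> exp 1 \<and> x \<ge> x2"
    using eventually_large[OF c(1) A] by (intro eventually_conj eventually_ge_at_top) auto
  then obtain x3 where x3: "\<And>x. x \<ge> x3 \<Longrightarrow>
      33 / 100 * x powr c - 99 / 512 * (x powr c + A) - A * ln x \<ge> 1 / 8 * (x powr c + A)
      \<and> x powr c \<ge> 200 \<and> x powr (c / 2) \<ge> M0 \<and> x \<ge> exp 1 \<and> x \<ge> x2"
    by (auto simp: eventually_at_top_linorder)
  show ?thesis
  proof (intro exI[of _ x3] allI impI)
    fix x :: real and L :: nat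
    assume "x3 \<le> x" and L0: "L > 0" and sqf: "squarefree L"
      and smooth: "\<forall>p. prime p \<longrightarrow> real p > x powr ((1 - B) / 2) \<longrightarrow> \<not> p dvd L"
      and sum: "(\<Sum>q\<in>prime_factors L. 1 / real q) \<le> (1 - B) / 32"
    note large = x3[OF \<open>x3 \<le> x\<close>]
    have "(1::real) < exp 1" by simp
    then have x: "x > 1" using large by linarith
    have "ln x \<ge> ln (exp 1)" using large x by (subst ln_le_cancel_iff) auto
    then have lnx: "ln x \<ge> 1" by simp
    define X where "X = x powr c"
    have "x2 \<le> x" using large by simp
    from x2[THEN spec, THEN mp, OF this] obtain E where E: "finite E" "card E \<le> D" "\<forall>m\<in>E. real_of_int m > ln x"
        and pi: "\<forall>(y::real) (a::int) (d::nat).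
           coprime a (int d) \<longrightarrow> 1 \<le> d \<longrightarrow>
           real d \<le> min (x powr B) (y / x powr (1 - B)) \<longrightarrow>
           (\<forall>m\<in>E. \<not> m dvd int d) \<longrightarrow>
           real (prime_pi_ap y d a) \<ge> real (prime_pi y) / (2 * real (totient d))"
      by (elim exE conjE) (rule that)
    have "\<forall>m\<in>E. m > 1" using E(3) lnx by force
    from exceptional_primes[OF E(1) this assms(3)]
    obtain T :: "nat set" where T: "finite T" "\<forall>p\<in>T. prime p" "card T \<le> card E + omega a"
      and T_avoid: "\<forall>d>0. (\<forall>p\<in>T. \<not> p dvd d) \<longrightarrow> coprime a (int d) \<and> (\<forall>m\<in>E. \<not> m dvd int d)"
      by (elim exE conjE) (rule that)
    define Div where "Div = {d. d dvd L \<and> real d \<le> x powr B \<and> (\<forall>p\<in>T. \<not> p dvd d)}"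
    have finDiv: "finite Div"
      using L0 unfolding Div_def by (auto intro: finite_subset[OF _ finite_divisors_nat])
    \<comment> \<open>The coprimality condition is independent of \<open>d\<close>; including it
      lets the pigeonhole choice of \<open>k\<close> carry it along.\<close>
    define good where "good d k \<longleftrightarrow> gcd (int k) (a * int L) = 1 \<and>
           real_of_int (int d * int k + a) \<le> x \<and> prime (int d * int k + a)" for d k :: nat
    define J where "J = {k::nat. 1 \<le> k \<and> real k \<le> X + A}"
    have J_eq: "J = {1..nat \<lfloor>X + A\<rfloor>}"
    proof -
      have "X + A \<ge> 0" using large by (simp add: X_def A_def)
      then show ?thesis by (auto simp: J_def le_nat_iff le_floor_iff)
    qed
    have "X \<ge> 200" using large by (simp add: X_def)
    then have XA: "X + A \<ge> 200" using A by simp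
    then have "1 \<in> J" by (simp add: J_def)
    have cardJ: "real (card J) \<le> X + A" using XA by (simp add: J_eq)
    have "1 / 8 / ln x * real (card J) \<le> real (card {k \<in> J. good d k})" if d: "d \<in> Div" for d
    proof -
      have d0: "d > 0" using d L0 by (auto simp: Div_def intro: Nat.gr0I)
      have dB: "real d \<le> x powr B" using d by (simp add: Div_def)
      have dX: "real d * X \<le> x"
      proof -
        have "real d * X \<le> x powr B * X" using dB by (intro mult_right_mono) (auto simp: X_def)
        also have "\<dots> = x" using x by (simp add: X_def c_def flip: powr_add)
        finally show ?thesis .
      qed
      have X0: "X > 0" using x by (simp add: X_def)
      have "coprime a (int d)" "\<forall>m\<in>E. \<not> m dvd int d"
        using T_avoid[rule_format, OF d0] d by (auto simp: Div_def)
      \<comment> \<open>The choice \<open>y = d * X\<close> is the least with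
        \<open>d <= y / x powr (1 - B)\<close>.\<close>
      then have "real (prime_pi_ap (real d * X) d a) \<ge> real (prime_pi (real d * X)) / (2 * real (totient d))"
        using d0 dB X0 by (intro pi[rule_format]) (auto simp: X_def c_def)
      then have "1 / 8 * (X + A) / ln x \<le>
         real (card {k::nat. 1 \<le> k \<and> real k \<le> X + A \<and> gcd (int k) (a * int L) = 1 \<and>
           real_of_int (int d * int k + a) \<le> x \<and> prime (int d * int k + a)})"
        unfolding A_def using large smooth sum x c L0 d0 assms(3) dX
        by (intro count_good[OF BT, where c = c]) (simp_all add: X_def c_def A_def)
      also have "{k::nat. 1 \<le> k \<and> real k \<le> X + A \<and> gcd (int k) (a * int L) = 1 \<and>
           real_of_int (int d * int k + a) \<le> x \<and> prime (int d * int k + a)} = {k \<in> J. good d k}"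
        by (auto simp: J_def good_def)
      finally have "1 / 8 * (X + A) / ln x \<le> real (card {k \<in> J. good d k})" .
      moreover have "1 / 8 / ln x * real (card J) \<le> 1 / 8 / ln x * (X + A)"
        using cardJ lnx by (intro mult_left_mono) auto
      ultimately show ?thesis by simp
    qed
    then obtain k where k: "k \<in> J" and large_fibre: "1 / 8 / ln x * real (card Div) \<le> real (card {d \<in> Div. good d k})"
      using ex_large_fibre[OF finDiv, of J "1 / 8 / ln x" good] \<open>1 \<in> J\<close> J_eq by fastforce
    define C where "C = {d::nat. d dvd L \<and> 1 \<le> d \<and> real d \<le> x powr B}"
    have C_eq: "C = {d. d dvd L \<and> real d \<le> x powr B}"
      using L0 by (auto simp: C_def Suc_le_eq intro: Nat.gr0I)
    have "card C \<le> 2 ^ card T * card Div"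
      unfolding C_eq Div_def using card_divisors_le_two_power[OF sqf L0 T(1)] T(2) by blast
    then have "real (card C) \<le> 2 ^ card T * real (card Div)"
      by (metis of_nat_le_iff of_nat_mult of_nat_numeral of_nat_power)
    also have "\<dots> \<le> 2 powr (real D + real (omega a)) * real (card Div)"
    proof (rule mult_right_mono)
      have "(2::real) ^ card T = 2 powr real (card T)" by (simp add: powr_realpow)
      also have "\<dots> \<le> 2 powr (real D + real (omega a))" using T(3) E(2) by (intro powr_mono) auto
      finally show "(2::real) ^ card T \<le> 2 powr (real D + real (omega a))" .
    qed simp
    finally have "2 powr (- real D - real (omega a) - 3) / ln x * real (card C) \<le>
        2 powr (- real D - real (omega a) - 3) / ln x * (2 powr (real D + real (omega a)) * real (card Div))"
      using lnx by (intro mult_left_mono) auto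
    \<comment> \<open>The \<open>3\<close> in the exponent is the \<open>1 / 8\<close> of
      \<open>count_good\<close>; the other powers of two cancel.\<close>
    also have "\<dots> = 1 / 8 / ln x * real (card Div)"
    proof -
      have "(2::real) powr (- real D - real (omega a) - 3) * 2 powr (real D + real (omega a)) = 2 powr (- 3)"
        by (simp flip: powr_add)
      also have "\<dots> = 1 / 8" by (simp add: powr_minus_divide)
      finally have "(2::real) powr (- real D - real (omega a) - 3) * 2 powr (real D + real (omega a)) = 1 / 8" .
      moreover have "u / ln x * (v * w) = (u * v) / ln x * w" for u v w :: real by simp
      ultimately show ?thesis by (simp only:)
    qed
    also note large_fibre
    finally have bound: "2 powr (- real D - real (omega a) - 3) / ln x * real (card C) \<le> real (card {d \<in> Div. good d k})" .
    \<comment> \<open>Coprimality of \<open>k\<close> is read off from some good \<open>d\<close>.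
      One exists because the lower bound is positive, \<open>1\<close> being among the divisors in
      \<open>C\<close>.\<close>
    have "{d \<in> Div. good d k} \<noteq> {}"
    proof -
      have "1 \<in> C" using L0 x B by (simp add: C_def ge_one_powr_ge_zero)
      moreover have "finite C" using L0 by (auto simp: C_def intro: finite_subset[OF _ finite_divisors_nat])
      ultimately have "real (card C) > 0" by (auto simp: card_gt_0_iff)
      then have "0 < 2 powr (- real D - real (omega a) - 3) / ln x * real (card C)"
        using lnx by (intro mult_pos_pos divide_pos_pos) auto
      then have "real (card {d \<in> Div. good d k}) > 0" using bound by linarith
      then show ?thesis by (metis card.empty of_nat_0 less_irrefl)
    qed
    then have "gcd (int k) (a * int L) = 1" by (auto simp: good_def)
    moreover have "card {d \<in> Div. good d k} \<le>
        card {d::nat. d dvd L \<and> real_of_int (int d * int k + a) \<le> x \<and> prime (int d * int k + a)}"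
      using L0 by (intro card_mono finite_subset[OF _ finite_divisors_nat]) (auto simp: Div_def good_def)
    ultimately show "\<exists>k::nat. k > 0 \<and>
        real k \<le> x powr (1 - B) + real_of_int \<bar>a\<bar> \<and>
        gcd (int k) (a * int L) = 1 \<and>
        real (card {d::nat. d dvd L \<and> real_of_int (int d * int k + a) \<le> x \<and>
                            prime (int d * int k + a)})
          \<ge> 2 powr (- real D - real (omega a) - 3) / ln x *
            real (card {d::nat. d dvd L \<and> 1 \<le> d \<and> real d \<le> x powr B})"
      using bound k by (intro exI[of _ k]) (auto simp: J_def X_def A_def c_def C_def)
  qed
qed

end
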